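(* Let $p>0$, $\alpha\in(-\infty,0)$, $\lambda>0$, $b\in\mathbb R^d$, and let $R\neq0$ be a finite Borel measure on $\mathbb R^d$ with $R(\{0\})=0$. Let $Y=\{Y_t:t\ge0\}$ be an OUTS process on $\mathbb R^d$ with parameter $\lambda$ and BDLP distribution $\mathrm{TS}^p_\alpha(\lambda R,\lambda b)$. If $t>0$, then for every $s\ge0$, given $Y_s=y$, we have $$ Y_{s+t} \stackrel{d}{=} e^{-\lambda t} y + (1-e^{-\lambda t})b +\sum_{n=1}^{N} V_n W_n, $$ where $N$, $V_1, V_2, \dots$, $W_1, W_2, \dots$ are independent random variables with: 1. $V_1, V_2, \dots$ are i.i.d. with distribution $R^1$, where $R^1(dx)=R(dx)/R(\mathbb R^{d})$; 2. $W_1, W_2, \dots$ are i.i.d. with distribution $\mathrm{DGGa}(|\alpha|,p,e^{\lambda t})$; 3. $N$ has a Poisson distribution with mean $p^{-1}\lambda t\, \Gamma(|\alpha|/p)\,R(\mathbb R^d)$.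
   Context: **$p$-tempered $\alpha$-stable distributions, $\alpha<0$.** For $\alpha<0$, $p>0$, a finite Borel measure $R$ on $\mathbb R^d$ with $R(\{0\})=0$, and $b\in\mathbb R^d$, $\mathrm{TS}^p_\alpha(R,b)$ is the (infinitely divisible) distribution on $\mathbb R^d$ with characteristic function $z\mapsto e^{c(z)}$, where $$ c(z) = i\langle b,z\rangle + \int_{\mathbb R^d}\int_0^\infty \left(e^{iu\langle x,z\rangle}-1\right) u^{-1-\alpha}e^{-u^p}\, du\, R(dx). $$ **OU and OUTS processes.** Given a Lévy process $L=\{L_t:t\ge0\}$ on $\mathbb R^d$ and $\lambda>0$, the OU process with parameter $\lambda$ and background driving Lévy process (BDLP) $L$ is the strong solution of $dY_t=-\lambda Y_t\,dt+dL_t$ with initial value $Y_0$ (independent of $L$), i.e. $Y_t=Y_0e^{-\lambda t}+\int_0^t e^{-\lambda(t-s)}dL_s$. It is a Markov process. The distribution of $L_1$ is called the BDLP distribution. If it is a $\mathrm{TS}^p_\alpha$ distribution, $Y$ is called an OUTS process. "Given $Y_s=y$, $Y_{s+t}\stackrel{d}{=}\cdots$" describes the transition law, i.e. the conditional distribution of $Y_{s+t}$ given $Y_s=y$. **DGGa distribution.** For $\gamma,p>0$ let $g_{\gamma,p,1}(u)=\frac{p}{\Gamma(\gamma/p)}u^{\gamma-1}e^{-u^p}$, $u>0$. For $\gamma,p>0$ and $\eta>1$, $\mathrm{DGGa}(\gamma,p,\eta)$ is the distribution on $(0,\infty)$ with probability density function $$ h_{\gamma,p,\eta}(x)=\frac{1}{x\log\eta}\int_x^{x\eta}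 g_{\gamma,p,1}(u)\,du,\quad x>0. $$ An empty sum $\sum_{n=1}^0$ is $0$. *)

theory Defs
  imports "HOL-Probability.Probability"
begin

definition char_fun :: "'a::euclidean_space measure \<Rightarrow> 'a \<Rightarrow> complex" where
  "char_fun \<mu> z = (LINT x|\<mu>. iexp (x \<bullet> z))"

definition TS_exponent ::
    "real \<Rightarrow> real \<Rightarrow> 'a::euclidean_space measure \<Rightarrow> 'a \<Rightarrow> 'a \<Rightarrow> complex" where
  "TS_exponent p \<alpha> R b z =
     \<i> * of_real (b \<bullet> z) +
     (LINT x|R. (LINT u:{0<..}|lborel.
        (iexp (u * (x \<bullet> z)) - 1) * of_real (u powr (- 1 - \<alpha>) * exp (- (u powr p)))))"

(* For p > 0, \<alpha> < 0 and R a finite Borel measure without mass at 0, there is exactly one such \<mu>. *)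
definition is_TS ::
    "real \<Rightarrow> real \<Rightarrow> 'a::euclidean_space measure \<Rightarrow> 'a \<Rightarrow> 'a measure \<Rightarrow> bool" where
  "is_TS p \<alpha> R b \<mu> \<longleftrightarrow>
     prob_space \<mu> \<and> sets \<mu> = sets borel \<and>
     (\<forall>z. char_fun \<mu> z = exp (TS_exponent p \<alpha> R b z))"

definition cadlag_on_nonneg :: "(real \<Rightarrow> 'a::topological_space) \<Rightarrow> bool" where
  "cadlag_on_nonneg f \<longleftrightarrow>
     (\<forall>t\<ge>0. (f \<longlongrightarrow> f t) (at_right t)) \<and> (\<forall>t>0. \<exists>l. (f \<longlongrightarrow> l) (at_left t))"

(* Processes are indexed by all reals; only the values at times t \<ge> 0 are constrained or used. *)
definition levy_process ::
    "'w measure \<Rightarrow> (real \<Rightarrow> 'w \<Rightarrow> 'a::euclidean_space) \<Rightarrow> bool" where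
  "levy_process M L \<longleftrightarrow>
     prob_space M \<and>
     (\<forall>t\<ge>0. L t \<in> borel_measurable M) \<and>
     (AE \<omega> in M. L 0 \<omega> = 0) \<and>
     (\<forall>(n::nat) \<tau>. 0 \<le> \<tau> 0 \<and> (\<forall>k<n. \<tau> k < \<tau> (Suc k)) \<longrightarrow>
        prob_space.indep_vars M (\<lambda>_. borel) (\<lambda>k \<omega>. L (\<tau> (Suc k)) \<omega> - L (\<tau> k) \<omega>) {..<n}) \<and>
     (\<forall>s\<ge>0. \<forall>t\<ge>0. distr M borel (\<lambda>\<omega>. L (s + t) \<omega> - L s \<omega>) = distr M borel (L t)) \<and>
     (\<forall>t\<ge>0. \<forall>\<epsilon>>0.
        ((\<lambda>s. measure M {\<omega> \<in> space M. \<epsilon> < dist (L s \<omega>) (L t \<omega>)}) \<longlongrightarrow> 0) (at t within {0..})) \<and>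
     (AE \<omega> in M. cadlag_on_nonneg (\<lambda>t. L t \<omega>))"

(* The equation dY = - rate Y dt + dL has additive noise, so its integral form
   Y t = Y 0 - rate * (integral of Y over [0,t]) + L t is a pathwise statement and involves no
   stochastic integral. It has only one cadlag solution, and Y t is determined by Y 0 and
   (L s) for s \<le> t; adaptedness up to null sets is therefore automatic and not required here. *)
definition OU_process ::
    "'w measure \<Rightarrow> real \<Rightarrow> (real \<Rightarrow> 'w \<Rightarrow> 'a::euclidean_space) \<Rightarrow> (real \<Rightarrow> 'w \<Rightarrow> 'a) \<Rightarrow> bool" where
  "OU_process M rate L Y \<longleftrightarrow>
     levy_process M L \<and>
     (\<forall>t\<ge>0. Y t \<in> borel_measurable M) \<and>
     prob_space.indep_set M
       (sets (vimage_algebra (space M) (Y 0) borel))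
       (sets (vimage_algebra (space M) (\<lambda>\<omega>. \<lambda>t\<in>{0..}. L t \<omega>) (\<Pi>\<^sub>M t\<in>{0..}. borel))) \<and>
     (AE \<omega> in M. cadlag_on_nonneg (\<lambda>t. Y t \<omega>) \<and>
        (\<forall>t\<ge>0. Y t \<omega> = Y 0 \<omega> - rate *\<^sub>R (LINT r:{0..t}|lborel. Y r \<omega>) + L t \<omega>))"

definition OUTS_process ::
    "'w measure \<Rightarrow> real \<Rightarrow> real \<Rightarrow> real \<Rightarrow> 'a::euclidean_space measure \<Rightarrow> 'a \<Rightarrow>
     (real \<Rightarrow> 'w \<Rightarrow> 'a) \<Rightarrow> (real \<Rightarrow> 'w \<Rightarrow> 'a) \<Rightarrow> bool" where
  "OUTS_process M rate p \<alpha> R b L Y \<longleftrightarrow>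
     OU_process M rate L Y \<and> is_TS p \<alpha> R b (distr M borel (L 1))"

definition gengamma_density :: "real \<Rightarrow> real \<Rightarrow> real \<Rightarrow> real" where
  "gengamma_density \<gamma> p u = p / Gamma (\<gamma> / p) * u powr (\<gamma> - 1) * exp (- (u powr p))"

definition DGGa_density :: "real \<Rightarrow> real \<Rightarrow> real \<Rightarrow> real \<Rightarrow> real" where
  "DGGa_density \<gamma> p \<eta> x =
     (if x > 0 then 1 / (x * ln \<eta>) * (LINT u:{x..x * \<eta>}|lborel. gengamma_density \<gamma> p u) else 0)"

definition DGGa :: "real \<Rightarrow> real \<Rightarrow> real \<Rightarrow> real measure" where
  "DGGa \<gamma> p \<eta> = density lborel (\<lambda>x. ennreal (DGGa_density \<gamma> p \<eta> x))"

(* K is a regular conditional distribution of X given Z: P(X \<in> B | Z) = K(Z, B) almost surely. *)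
definition cond_distribution ::
    "'w measure \<Rightarrow> ('w \<Rightarrow> 'b::topological_space) \<Rightarrow> ('w \<Rightarrow> 'c::topological_space) \<Rightarrow>
     ('c \<Rightarrow> 'b measure) \<Rightarrow> bool" where
  "cond_distribution M X Z K \<longleftrightarrow>
     K \<in> borel \<rightarrow>\<^sub>M prob_algebra borel \<and>
     (\<forall>B\<in>sets borel. AE \<omega> in M.
        real_cond_exp M (vimage_algebra (space M) Z borel) (indicator (X -` B \<inter> space M)) \<omega>
          = measure (K (Z \<omega>)) B)"

(* Joint independence of N, V 1, V 2, ..., W 1, W 2, ...; indep_vars needs a common codomain,
   so independence is stated for the generated sigma-algebras. *)
datatype var_index = Count | Jump nat | Factor nat

definition indep_NVW ::
    "'w measure \<Rightarrow> ('w \<Rightarrow> nat) \<Rightarrow> (nat \<Rightarrow> 'w \<Rightarrow> 'a::topological_space) \<Rightarrow> (nat \<Rightarrow> 'w \<Rightarrow> real) \<Rightarrow> bool" where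
  "indep_NVW M N V W \<longleftrightarrow>
     prob_space.indep_sets M
       (\<lambda>i. case i of
           Count \<Rightarrow> sets (vimage_algebra (space M) N (count_space UNIV))
         | Jump n \<Rightarrow> sets (vimage_algebra (space M) (V n) borel)
         | Factor n \<Rightarrow> sets (vimage_algebra (space M) (W n) borel))
       (insert Count (Jump ` {1..} \<union> Factor ` {1..}))"

end

theory Submission
  imports Defs
begin

text \<open>Solving the equation of the process pathwise gives
  \<open>Y (s + t) - exp (- rate * t) *\<^sub>R Y s\<close> as an almost sure limit of weighted sums of increments
  of \<open>L\<close> after time \<open>s\<close>. Hence the joint characteristic function of \<open>Y s\<close> and this difference
  factorises, and the second factor is the exponential of the integral over \<open>{0<..t}\<close> of the
  exponent of \<open>L\<close> along \<open>exp (- rate * (t - r)) *\<^sub>R w\<close>. Substituting \<open>q = exp (rate * (t - r))\<close> and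
  using that a \<open>DGGa\<close> variable is a quotient \<open>U / Q\<close> with \<open>U\<close> generalized gamma and \<open>Q\<close>
  log-uniform turns this factor into the characteristic function of a shifted compound Poisson
  sum, and uniqueness of characteristic functions finishes the proof.\<close>

section \<open>Uniqueness of characteristic functions in Euclidean spaces\<close>

text \<open>For \<open>h = 1 / n\<close> the law of \<open>L h\<close> is known only through the
  \<open>n\<close>-th power of its characteristic function, which leaves a root of unity open.
  Continuity in the frequency and connectedness of the space fix it, and right continuity of the
  paths carries the formula \<open>exp (h * c z)\<close> from rational to real \<open>h\<close>. The
  constants fit together as follows. The BDLP parameters carry a factor \<open>rate\<close>, which
  the substitution consumes because dq / q = - rate dr; so \<open>R\<close> itself remains. With
  \<eta> = exp (rate * t) the unnormalised measure dq / q on [1, \<eta>] has mass rate * t, and the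
  tempering measure has mass Gamma (|\<alpha>| / p) / p. Their product with the mass of
  \<open>R\<close> is the Poisson mean, and normalising the three measures gives the laws of Q, U
  and the \<open>V n\<close>. Finiteness and mass of the tempering measure are read off from the law
  of \<open>W 1\<close> being a probability measure. Separate frequencies \<open>z\<close> and
  \<open>w\<close> for \<open>Y s\<close> and the difference turn independence into a product
  formula on the product space.\<close>

text \<open>\<open>Levy_uniqueness\<close> speaks of probability measures. Both measures are
  therefore divided by their common mass, which is the value of \<open>char\<close> at 0, and
  multiplied back afterwards; mass zero is a separate case.\<close>

lemma finite_borel_measure_eqI_char:
  assumes "finite_measure M1" "finite_measure M2"
    and [measurable_cong]: "sets M1 = sets borel" "sets M2 = sets borel"
    and eq: "\<And>t. char M1 t = char M2 t"
  shows "M1 = M2"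
proof -
  interpret M1: finite_measure M1 by fact
  interpret M2: finite_measure M2 by fact
  have sp: "space M1 = UNIV" "space M2 = UNIV"
    using assms(3,4) by (auto dest: sets_eq_imp_space_eq)
  define m where "m = measure M1 UNIV"
  have m2: "measure M2 UNIV = m"
    using eq[of 0] sp by (simp add: char_def m_def)
  have e: "emeasure M1 UNIV = m" "emeasure M2 UNIV = m"
    using m2 by (simp_all add: M1.emeasure_eq_measure M2.emeasure_eq_measure m_def)
  show ?thesis
  proof (cases "m = 0")
    case True
    show ?thesis
    proof (rule measure_eqI)
      fix A assume "A \<in> sets M1"
      have "emeasure M1 A \<le> 0" "emeasure M2 A \<le> 0"
        using emeasure_space[of M1 A] emeasure_space[of M2 A] e True sp by auto
      then show "emeasure M1 A = emeasure M2 A" by simp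
    qed (simp add: assms)
  next
    case False
    then have m: "m > 0" using m_def by (simp add: less_le)
    have *: "real_distribution (density M (\<lambda>_. ennreal (1 / m)))"
      if "sets M = sets borel" "emeasure M UNIV = m" for M :: "real measure"
    proof -
      have "space M = UNIV" using that(1) by (auto dest: sets_eq_imp_space_eq)
      then show ?thesis
        unfolding real_distribution_def real_distribution_axioms_def using that m
        by (auto intro!: prob_spaceI simp: emeasure_density nn_integral_cmult ennreal_mult[symmetric])
    qed
    have ch: "char (density M (\<lambda>_. ennreal (1 / m))) t = char M t / m"
      if "sets M = sets borel" for M t
      unfolding char_def using m that
      by (subst integral_density) (auto simp: measurable_def scaleR_conv_of_real divide_inverse mult.commute)
    have "density M1 (\<lambda>_. ennreal (1 / m)) = density M2 (\<lambda>_. ennreal (1 / m))"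
      using * e assms by (intro Levy_uniqueness ext) (auto simp: ch)
    then have "density (density M1 (\<lambda>_. ennreal (1 / m))) (\<lambda>_. ennreal m) =
        density (density M2 (\<lambda>_. ennreal (1 / m))) (\<lambda>_. ennreal m)" by simp
    then show ?thesis
      using m by (simp add: density_density_eq ennreal_mult[symmetric] density_1)
  qed
qed

lemma prod_indicator_bounds:
  "0 \<le> (\<Prod>i\<in>S. indicator (A i) (f i) :: real)" "(\<Prod>i\<in>S. indicator (A i) (f i) :: real) \<le> 1"
  by (auto intro!: prod_nonneg prod_le_1 simp: indicator_def)

lemma integrable_weighted_iexp:
  fixes M :: "'a::euclidean_space measure"
  assumes "finite_measure M" and [measurable_cong]: "sets M = sets borel"
    and [measurable]: "P \<in> borel_measurable borel" and "\<And>x. \<bar>P x\<bar> \<le> B"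
  shows "integrable M (\<lambda>x. of_real (P x) * iexp (x \<bullet> z))"
proof -
  interpret finite_measure M by fact
  show ?thesis
    by (rule integrable_const_bound[where B=B]) (auto simp: norm_mult assms)
qed

text \<open>A weight \<open>1 + cos (x \<bullet> z + \<theta>)\<close> is nonnegative, so the one-dimensional uniqueness theorem
  applies to the corresponding weighted image measures although \<open>iexp (x \<bullet> z)\<close> is not real.\<close>

lemma char_fun_eq_imp_rectangle_eq:
  fixes M1 M2 :: "'a::euclidean_space measure"
  assumes fin: "finite_measure M1" "finite_measure M2"
    and s[measurable_cong]: "sets M1 = sets borel" "sets M2 = sets borel"
    and eq: "\<And>z. char_fun M1 z = char_fun M2 z"
    and "finite S" and A: "\<And>i. i \<in> S \<Longrightarrow> A i \<in> sets borel"
  shows "(LINT x|M1. of_real (\<Prod>i\<in>S. indicator (A i) (x \<bullet> i)) * iexp (x \<bullet> z)) =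
         (LINT x|M2. of_real (\<Prod>i\<in>S. indicator (A i) (x \<bullet> i)) * iexp (x \<bullet> z))"
  using \<open>finite S\<close> A
proof (induction S arbitrary: z)
  case empty
  then show ?case using eq by (simp add: char_fun_def)
next
  case (insert j S)
  define P :: "'a \<Rightarrow> real" where "P x = (\<Prod>i\<in>S. indicator (A i) (x \<bullet> i))" for x
  have [measurable]: "A i \<in> sets borel" if "i \<in> insert j S" for i using insert.prems that by auto
  have Pm[measurable]: "P \<in> borel_measurable borel" unfolding P_def by measurable
  have P: "0 \<le> P x" "P x \<le> 1" for x unfolding P_def by (fact prod_indicator_bounds)+
  have aP: "\<bar>P x\<bar> \<le> 1" for x using P[of x] by simp
  \<comment> \<open>The hypothesis is needed at every frequency, because the weights below shift it
    by \<open>z\<close> in both directions.\<close>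
  have IH: "(LINT x|M1. of_real (P x) * iexp (x \<bullet> z)) = (LINT x|M2. of_real (P x) * iexp (x \<bullet> z))" for z
    using insert.IH insert.prems unfolding P_def by auto
  define w where "w z \<theta> x = P x * (1 + cos (x \<bullet> z + \<theta>))" for z \<theta> and x :: 'a
  have [measurable]: "w z \<theta> \<in> borel_measurable borel" for z \<theta> unfolding w_def by measurable
  have w0: "0 \<le> w z \<theta> x" for z \<theta> x
    unfolding w_def using P by (intro mult_nonneg_nonneg) (simp_all add: add_nonneg_nonneg, smt (verit) cos_ge_minus_one)
  have w2: "w z \<theta> x \<le> 2" for z \<theta> x
  proof -
    have "w z \<theta> x \<le> 1 * 2"
      unfolding w_def using P by (intro mult_mono) (auto, smt (verit) cos_ge_minus_one)
    then show ?thesis by simp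
  qed
  \<comment> \<open>The law of the new coordinate under the weighted measure. Its one-dimensional
    characteristic function sees \<open>P\<close> together with the frequency
    \<open>z\<close>.\<close>
  define D where "D M z \<theta> = distr (density M (\<lambda>x. ennreal (w z \<theta> x))) borel (\<lambda>x. x \<bullet> j)"
    for M :: "'a measure" and z \<theta>
  \<comment> \<open>Writing the cosine as two exponentials leaves three integrals, at the
    frequencies \<open>r *\<^sub>R j\<close> and \<open>r *\<^sub>R j\<close> plus or minus
    \<open>z\<close>; all of them are covered by \<open>IH\<close>.\<close>
  have D_char: "char (D M z \<theta>) r = (LINT x|M. of_real (P x) * iexp (x \<bullet> (r *\<^sub>R j)))
      + iexp \<theta> / 2 * (LINT x|M. of_real (P x) * iexp (x \<bullet> (r *\<^sub>R j + z)))
      + iexp (- \<theta>) / 2 * (LINT x|M. of_real (P x) * iexp (x \<bullet> (r *\<^sub>R j - z)))"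
    if M: "finite_measure M" and [measurable_cong]: "sets M = sets borel" for M z \<theta> r
  proof -
    have int: "integrable M (\<lambda>x. of_real (P x) * iexp (x \<bullet> u))" for u
      using aP by (intro integrable_weighted_iexp[OF M that(2) Pm, where B=1]) simp
    have "char (D M z \<theta>) r = (LINT x|M. of_real (w z \<theta> x) * iexp (r * (x \<bullet> j)))"
      unfolding char_def D_def using w0
      by (simp add: integral_distr integral_density scaleR_conv_of_real)
    also have "\<dots> = (LINT x|M. of_real (P x) * iexp (x \<bullet> (r *\<^sub>R j))
      + iexp \<theta> / 2 * (of_real (P x) * iexp (x \<bullet> (r *\<^sub>R j + z)))
      + iexp (- \<theta>) / 2 * (of_real (P x) * iexp (x \<bullet> (r *\<^sub>R j - z))))"
    proof (rule Bochner_Integration.integral_cong[OF refl])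
      fix x
      have cos: "complex_of_real (cos y) = (iexp y + iexp (- y)) / 2" for y
        using cos_exp_eq[of "complex_of_real y"] by (simp add: cos_of_real)
      have "of_real (w z \<theta> x) * iexp (r * (x \<bullet> j)) = of_real (P x) *
         (1 + (iexp (x \<bullet> z + \<theta>) + iexp (-(x \<bullet> z + \<theta>))) / 2) * iexp (r * (x \<bullet> j))"
        unfolding w_def by (simp only: of_real_mult of_real_add of_real_1 cos)
      also have "\<dots> = of_real (P x) * iexp (x \<bullet> (r *\<^sub>R j))
        + iexp \<theta> / 2 * (of_real (P x) * iexp (x \<bullet> (r *\<^sub>R j + z)))
        + iexp (- \<theta>) / 2 * (of_real (P x) * iexp (x \<bullet> (r *\<^sub>R j - z)))"
        by (simp add: inner_add_right inner_diff_right exp_add exp_diff exp_minus field_simps)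
      finally show "of_real (w z \<theta> x) * iexp (r * (x \<bullet> j)) = \<dots>" .
    qed
    also have "\<dots> = (LINT x|M. of_real (P x) * iexp (x \<bullet> (r *\<^sub>R j)))
      + iexp \<theta> / 2 * (LINT x|M. of_real (P x) * iexp (x \<bullet> (r *\<^sub>R j + z)))
      + iexp (- \<theta>) / 2 * (LINT x|M. of_real (P x) * iexp (x \<bullet> (r *\<^sub>R j - z)))"
      by (subst Bochner_Integration.integral_add Bochner_Integration.integral_mult_right_zero
          | intro Bochner_Integration.integrable_add integrable_mult_right int)+ (rule refl)
    finally show ?thesis .
  qed
  have D_fin: "finite_measure (D M z \<theta>)"
    if M: "finite_measure M" and [measurable_cong]: "sets M = sets borel" for M z \<theta>
  proof -
    interpret finite_measure M by fact
    have "(\<integral>\<^sup>+x. ennreal (w z \<theta> x) \<partial>M) \<le> (\<integral>\<^sup>+x. ennreal 2 \<partial>M)"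
      by (intro nn_integral_mono ennreal_leI w2)
    also have "\<dots> < \<infinity>" by (simp add: ennreal_mult_less_top emeasure_eq_measure)
    finally have "emeasure (density M (\<lambda>x. ennreal (w z \<theta> x))) (space M) < \<infinity>"
      by (simp add: emeasure_density)
    then have "finite_measure (density M (\<lambda>x. ennreal (w z \<theta> x)))"
      by (intro finite_measureI) simp
    moreover have "(\<lambda>x. x \<bullet> j) \<in> density M (\<lambda>x. ennreal (w z \<theta> x)) \<rightarrow>\<^sub>M borel"
      by measurable
    ultimately show ?thesis
      unfolding D_def by (rule finite_measure.finite_measure_distr)
  qed
  have D_eq: "D M1 z \<theta> = D M2 z \<theta>" for z \<theta>
  proof (rule finite_borel_measure_eqI_char)
    show "char (D M1 z \<theta>) r = char (D M2 z \<theta>) r" for r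
      unfolding D_char[OF fin(1) s(1)] D_char[OF fin(2) s(2)] IH ..
  qed (rule D_fin[OF fin(1) s(1)], rule D_fin[OF fin(2) s(2)], simp_all add: D_def)
  define Q :: "'a \<Rightarrow> real" where "Q x = P x * indicator (A j) (x \<bullet> j)" for x
  have Qm[measurable]: "Q \<in> borel_measurable borel" unfolding Q_def by measurable
  have Q: "\<bar>Q x\<bar> \<le> 1" for x unfolding Q_def using P[of x] by (auto simp: indicator_def)
  define I where "I M z \<theta> = (LINT x|M. complex_of_real (Q x * (1 + cos (x \<bullet> z + \<theta>))))"
    for M :: "'a measure" and z \<theta>
  have I: "I M z \<theta> = (LINT y|D M z \<theta>. of_real (indicator (A j) y))"
    if [measurable_cong]: "sets M = sets borel" for M z \<theta>
  proof -
    have "(LINT y|D M z \<theta>. \<phi> y) = (LINT x|M. of_real (w z \<theta> x) * \<phi> (x \<bullet> j))"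
      if [measurable]: "\<phi> \<in> borel_measurable borel" for \<phi> :: "real \<Rightarrow> complex"
      unfolding D_def using w0
      by (simp add: integral_distr integral_density scaleR_conv_of_real)
    then have "(LINT y|D M z \<theta>. complex_of_real (indicator (A j) y)) =
        (LINT x|M. of_real (w z \<theta> x) * of_real (indicator (A j) (x \<bullet> j)))" by measurable
    also have "\<dots> = I M z \<theta>"
      unfolding I_def by (intro Bochner_Integration.integral_cong refl) (simp add: Q_def w_def mult_ac)
    finally show ?thesis by (rule sym)
  qed
  have I_eq: "I M1 z \<theta> = I M2 z \<theta>" for z \<theta> using D_eq I s by simp
  \<comment> \<open>The phases 0 and - pi / 2 give the weights 1 + cos and 1 + sin. The surplus
    \<open>(1 + \<i>)\<close> times the integral of \<open>Q\<close> is removed with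
    \<open>I M 0 0\<close>, which is twice that integral.\<close>
  have rep: "(LINT x|M. of_real (Q x) * iexp (x \<bullet> z)) = I M z 0 + \<i> * I M z (- pi / 2) - (1 + \<i>) / 2 * I M 0 0"
    if M: "finite_measure M" and [measurable_cong]: "sets M = sets borel" for M
  proof -
    interpret finite_measure M by fact
    have int: "integrable M (\<lambda>x. complex_of_real (Q x * (1 + cos (x \<bullet> z + \<theta>))))" for z \<theta>
    proof (rule integrable_const_bound[where B=2])
      have "\<bar>Q x\<bar> * \<bar>1 + cos (x \<bullet> z + \<theta>)\<bar> \<le> 1 * 2" for x
        using Q by (intro mult_mono) (auto simp: abs_le_iff, (smt (verit) cos_ge_minus_one)+)
      then show "AE x in M. norm (complex_of_real (Q x * (1 + cos (x \<bullet> z + \<theta>)))) \<le> 2"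
        by (simp add: abs_mult norm_mult del: of_real_mult of_real_add)
    qed measurable
    have "(LINT x|M. of_real (Q x) * iexp (x \<bullet> z)) = (LINT x|M. of_real (Q x * (1 + cos (x \<bullet> z + 0)))
      + \<i> * of_real (Q x * (1 + cos (x \<bullet> z + - pi / 2))) - (1 + \<i>) / 2 * of_real (Q x * (1 + cos (x \<bullet> 0 + 0))))"
    proof (rule Bochner_Integration.integral_cong[OF refl])
      fix x
      have "cos (x \<bullet> z + - pi / 2) = sin (x \<bullet> z)" by (simp add: cos_diff)
      then show "of_real (Q x) * iexp (x \<bullet> z) = of_real (Q x * (1 + cos (x \<bullet> z + 0)))
      + \<i> * of_real (Q x * (1 + cos (x \<bullet> z + - pi / 2))) - (1 + \<i>) / 2 * of_real (Q x * (1 + cos (x \<bullet> 0 + 0)))"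
        by (simp add: exp_Euler cos_of_real sin_of_real algebra_simps)
    qed
    also have "\<dots> = I M z 0 + \<i> * I M z (- pi / 2) - (1 + \<i>) / 2 * I M 0 0"
      unfolding I_def
      by (subst Bochner_Integration.integral_add Bochner_Integration.integral_diff
           Bochner_Integration.integral_mult_right_zero
          | intro Bochner_Integration.integrable_add integrable_mult_right int)+ (rule refl)
    finally show ?thesis .
  qed
  have "(\<Prod>i\<in>insert j S. indicator (A i) (x \<bullet> i)) = Q x" for x
    using insert.hyps by (simp add: Q_def P_def mult.commute)
  then show ?case using rep[OF fin(1) s(1)] rep[OF fin(2) s(2)] I_eq by simp
qed

text \<open>The indicator of a box is the product of indicators of its coordinate intervals, so the
  preceding lemma for \<open>Basis\<close> at frequency 0 gives equal measures of all boxes, and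
  open boxes form an intersection-stable generator.\<close>

lemma char_fun_unique:
  fixes M1 M2 :: "'a::euclidean_space measure"
  assumes fin: "finite_measure M1" "finite_measure M2"
    and s[measurable_cong]: "sets M1 = sets borel" "sets M2 = sets borel"
    and eq: "\<And>z. char_fun M1 z = char_fun M2 z"
  shows "M1 = M2"
proof -
  let ?E = "range (\<lambda>(a, b). box a b) :: 'a set set"
  let ?B = "\<lambda>n::nat. box (- real n *\<^sub>R One) (real n *\<^sub>R One) :: 'a set"
  have box: "measure M (box a b) = Re (LINT x|M. of_real (\<Prod>i\<in>Basis. indicator {a \<bullet> i<..<b \<bullet> i} (x \<bullet> i)) * iexp (x \<bullet> 0))"
    if [measurable_cong]: "sets M = sets borel" for M and a b :: 'a
  proof -
    have "(\<Prod>i\<in>Basis. indicator {a \<bullet> i<..<b \<bullet> i} (x \<bullet> i) :: real) = indicator (box a b) x" for x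
      by (auto simp: indicator_def box_def prod_zero_iff)
    then show ?thesis using that sets_eq_imp_space_eq[OF that]
      by (simp add: of_real_prod[symmetric] del: of_real_prod)
  qed
  have m: "measure M1 (box a b) = measure M2 (box a b)" for a b :: 'a
    using char_fun_eq_imp_rectangle_eq[OF fin s eq, of Basis "\<lambda>i. {a \<bullet> i<..<b \<bullet> i}" 0] s
    by (simp add: box)
  interpret M1: finite_measure M1 by fact
  interpret M2: finite_measure M2 by fact
  show ?thesis
  proof (rule measure_eqI_generator_eq)
    show "Int_stable ?E" by (auto simp: Int_stable_def box_Int_box)
    show "?E \<subseteq> Pow UNIV" "sets M1 = sigma_sets UNIV ?E" "sets M2 = sigma_sets UNIV ?E"
      using s by (simp_all add: borel_eq_box sets_measure_of)
    show "range ?B \<subseteq> ?E" by auto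
    show "(\<Union>i. ?B i) = UNIV" using UN_box_eq_UNIV by simp
    show "emeasure M1 (?B i) \<noteq> \<infinity>" for i by (simp add: M1.emeasure_eq_measure)
    show "emeasure M1 X = emeasure M2 X" if "X \<in> ?E" for X
      using that m by (auto simp: M1.emeasure_eq_measure M2.emeasure_eq_measure)
  qed
qed

section \<open>Pathwise solution of the Ornstein--Uhlenbeck equation\<close>

text \<open>Every time has a neighbourhood in which \<open>f\<close> stays close to its left limit
  on one side and to its value on the other. Finitely many such neighbourhoods cover the compact
  interval.\<close>

lemma cadlag_bounded:
  fixes f :: "real \<Rightarrow> 'a::real_normed_vector"
  assumes f: "cadlag_on_nonneg f"
  obtains B where "\<And>r. 0 \<le> r \<Longrightarrow> r \<le> T \<Longrightarrow> norm (f r) \<le> B"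
proof -
  have "\<exists>U. open U \<and> x \<in> U \<and> bounded (f ` (U \<inter> {0..}))" if "x \<ge> 0" for x
  proof -
    have "(f \<longlongrightarrow> f x) (at_right x)" using f that by (auto simp: cadlag_on_nonneg_def)
    then have "eventually (\<lambda>y. dist (f y) (f x) < 1) (at_right x)" by (rule tendstoD) simp
    then obtain b where b: "b > x" "\<And>y. x < y \<Longrightarrow> y < b \<Longrightarrow> dist (f y) (f x) < 1"
      unfolding eventually_at_right_field by auto
    obtain a C where a: "a < x" "bounded C" "\<And>y. a < y \<Longrightarrow> y < x \<Longrightarrow> 0 \<le> y \<Longrightarrow> f y \<in> C"
    proof (cases "x = 0")
      case True
      \<comment> \<open>To the left of time 0 there are no admissible times, so the empty set bounds
        the values there.\<close>
      then show ?thesis using that[of "-1" "{}"] by auto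
    next
      case False
      then obtain l where "(f \<longlongrightarrow> l) (at_left x)"
        using f \<open>x \<ge> 0\<close> by (metis cadlag_on_nonneg_def order_le_less)
      then have "eventually (\<lambda>y. dist (f y) l < 1) (at_left x)" by (rule tendstoD) simp
      then obtain a where "a < x" "\<And>y. a < y \<Longrightarrow> y < x \<Longrightarrow> dist (f y) l < 1"
        unfolding eventually_at_left_field by auto
      then show ?thesis using that[of a "ball l 1"] by (auto simp: dist_commute)
    qed
    have "f ` ({a<..<b} \<inter> {0..}) \<subseteq> C \<union> ball (f x) 1"
    proof safe
      fix y assume y: "y \<in> {a<..<b}" "y \<ge> 0" "f y \<notin> ball (f x) 1"
      then have "y < x" using b(2)[of y] by (cases y x rule: linorder_cases) (auto simp: dist_commute)
      then show "f y \<in> C" using a y by auto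
    qed
    then have "bounded (f ` ({a<..<b} \<inter> {0..}))"
      using a(2) by (meson bounded_Un bounded_ball bounded_subset)
    then show ?thesis using a(1) b(1) by (intro exI[of _ "{a<..<b}"]) auto
  qed
  then obtain U where U: "\<And>x. x \<ge> 0 \<Longrightarrow> open (U x) \<and> x \<in> U x \<and> bounded (f ` (U x \<inter> {0..}))"
    by metis
  obtain C where C: "C \<subseteq> {0..T}" "finite C" "{0..T} \<subseteq> (\<Union>c\<in>C. U c)"
    by (rule compactE_image[of "{0..T}" "{0..T}" U]) (use U in auto)
  have "bounded (\<Union>c\<in>C. f ` (U c \<inter> {0..}))"
    using C U by (intro bounded_UN) auto
  then obtain B where "\<forall>y\<in>(\<Union>c\<in>C. f ` (U c \<inter> {0..})). norm y \<le> B" by (auto simp: bounded_iff)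
  then show ?thesis using C(3) by (intro that[of B]) (auto simp: subset_iff)
qed

section \<open>Rounding up to a grid and integrals of step functions\<close>

definition grid_up :: "real \<Rightarrow> real \<Rightarrow> nat \<Rightarrow> real \<Rightarrow> real" where
  "grid_up a T n r = a + T * of_int \<lceil>(r - a) * real n / T\<rceil> / real n"

lemma grid_up_bounds:
  fixes T r a :: real
  assumes "T > 0" "n > 0"
  shows "r \<le> grid_up a T n r" "grid_up a T n r < r + T / n"
proof -
  let ?x = "(r - a) * real n / T"
  have eq: "?x * (T / n) = r - a" "(?x + 1) * (T / n) = r - a + T / n"
    using assms by (auto simp: field_simps)
  have "?x * (T / n) \<le> of_int \<lceil>?x\<rceil> * (T / n)" using assms by (intro mult_right_mono) auto
  then show "r \<le> grid_up a T n r" using eq by (simp add: grid_up_def mult.commute)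
  have "of_int \<lceil>?x\<rceil> * (T / n) < (?x + 1) * (T / n)"
    using assms by (intro mult_strict_right_mono, linarith) auto
  then show "grid_up a T n r < r + T / n" using eq by (simp add: grid_up_def mult.commute)
qed

lemma grid_up_cell:
  fixes T r :: real and n k :: nat
  assumes "T > 0" "n > 0" "a + T * k / n < r" "r \<le> a + T * Suc k / n"
  shows "grid_up a T n r = a + T * Suc k / n"
proof -
  have "T * k < (r - a) * n" "(r - a) * n \<le> T * Suc k"
    using assms by (auto simp: field_simps)
  then have "real k < (r - a) * n / T" "(r - a) * n / T \<le> real (Suc k)"
    using assms(1) by (auto simp: pos_less_divide_eq pos_divide_le_eq mult.commute)
  then have "\<lceil>(r - a) * real n / T\<rceil> = int (Suc k)" by (intro ceiling_unique) auto
  then show ?thesis by (simp add: grid_up_def)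
qed

lemma grid_up_le_end:
  fixes T :: real
  assumes "T > 0" "n > 0" "r \<le> a + T"
  shows "grid_up a T n r \<le> a + T"
proof -
  have "(r - a) * n \<le> T * n" using assms by (intro mult_right_mono) auto
  then have "(r - a) * n / T \<le> of_int (int n)" using assms by (simp add: pos_divide_le_eq mult.commute)
  then have "\<lceil>(r - a) * n / T\<rceil> \<le> int n" by (simp only: ceiling_le_iff)
  then have "real_of_int \<lceil>(r - a) * n / T\<rceil> \<le> real n" by linarith
  then show ?thesis using assms by (simp add: grid_up_def field_simps)
qed

lemma grid_up_tendsto:
  assumes "T > 0"
  shows "(\<lambda>m. grid_up a T (Suc m) r) \<longlonglongrightarrow> r"
proof (rule tendsto_sandwich)
  show "\<forall>\<^sub>F m in sequentially. r \<le> grid_up a T (Suc m) r"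
    "\<forall>\<^sub>F m in sequentially. grid_up a T (Suc m) r \<le> r + T / real (Suc m)"
    using grid_up_bounds[OF assms] by (auto intro!: always_eventually less_imp_le simp del: of_nat_Suc)
  have "(\<lambda>m. r + T / real (Suc m)) \<longlonglongrightarrow> r + 0"
    by (intro tendsto_intros LIMSEQ_Suc lim_const_over_n)
  then show "(\<lambda>m. r + T / real (Suc m)) \<longlonglongrightarrow> r" by simp
qed simp

text \<open>Rounding upwards keeps the grid points in \<open>{r..}\<close>, where the path is
  continuous at \<open>r\<close>. Rounding down would produce left limits at jumps.\<close>

lemma cadlag_grid_up:
  assumes "cadlag_on_nonneg f" "T > 0" "r \<ge> 0"
  shows "(\<lambda>m. f (grid_up a T (Suc m) r)) \<longlonglongrightarrow> f r"
proof (rule continuous_within_tendsto_compose[where S="{r..}"])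
  show "continuous (at r within {r..}) f"
    using assms by (auto simp: continuous_within at_within_Ici_at_right cadlag_on_nonneg_def)
  show "\<forall>\<^sub>F m in sequentially. grid_up a T (Suc m) r \<in> {r..}"
    using grid_up_bounds[OF assms(2)] by auto
qed (rule grid_up_tendsto[OF assms(2)])

lemma grid_up_measurable [measurable]: "grid_up a T n \<in> borel_measurable borel"
  unfolding grid_up_def[abs_def] by measurable

text \<open>The map factors through the integer under the ceiling, and every map out of a
  \<open>count_space\<close> is measurable. This supplies the measurable approximations of cadlag
  paths.\<close>

lemma comp_grid_up_measurable [measurable]:
  fixes f :: "real \<Rightarrow> 'a::topological_space"
  shows "(\<lambda>r. f (grid_up a T n r)) \<in> borel_measurable borel"
  unfolding grid_up_def
  by (rule measurable_compose[where g="\<lambda>i. f (a + T * of_int i / real n)" and N="count_space UNIV"])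
     measurable

lemma cadlag_measurable:
  fixes f :: "real \<Rightarrow> 'a::{real_normed_vector, second_countable_topology}"
  assumes "cadlag_on_nonneg f" "0 \<le> a"
  shows "set_borel_measurable borel {a<..b} f"
  unfolding set_borel_measurable_def
proof (rule borel_measurable_LIMSEQ_metric)
  show "(\<lambda>r. indicator {a<..b} r *\<^sub>R f (grid_up 0 1 (Suc m) r)) \<in> borel_measurable borel" for m
    by measurable
  show "(\<lambda>m. indicator {a<..b} r *\<^sub>R f (grid_up 0 1 (Suc m) r)) \<longlonglongrightarrow> indicator {a<..b} r *\<^sub>R f r" for r
    using assms cadlag_grid_up[of f 1 r 0] by (auto simp: indicator_def)
qed

lemma integrable_indicator_Ioc_scaleR [simp]:
  fixes a b :: real and B :: "'a::{banach, second_countable_topology}"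
  shows "integrable lborel (\<lambda>r. indicator {a<..b} r *\<^sub>R B)"
  by (intro integrable_scaleR_left integrable_real_indicator, simp, cases "a \<le> b") auto

lemma set_integrable_bounded:
  fixes f :: "real \<Rightarrow> 'a::{banach, second_countable_topology}"
  assumes "set_borel_measurable borel {a<..b} f" "\<And>r. a < r \<Longrightarrow> r \<le> b \<Longrightarrow> norm (f r) \<le> B"
  shows "set_integrable lborel {a<..b} f"
  unfolding set_integrable_def
proof (rule Bochner_Integration.integrable_bound)
  show "integrable lborel (\<lambda>r. indicator {a<..b} r *\<^sub>R B)"
    by (rule integrable_indicator_Ioc_scaleR)
  show "(\<lambda>r. indicator {a<..b} r *\<^sub>R f r) \<in> borel_measurable lborel"
    using assms(1) by (simp add: set_borel_measurable_def)
  show "AE r in lborel. norm (indicator {a<..b} r *\<^sub>R f r) \<le> norm (indicator {a<..b} r *\<^sub>R B)"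
    using assms(2) by (auto simp: indicator_def intro!: AE_I2, fastforce)
qed

lemma cadlag_set_integrable:
  fixes f :: "real \<Rightarrow> 'a::{banach, second_countable_topology}"
  assumes "cadlag_on_nonneg f" "0 \<le> a"
  shows "set_integrable lborel {a<..b} f"
proof -
  obtain B where "\<And>r. 0 \<le> r \<Longrightarrow> r \<le> b \<Longrightarrow> norm (f r) \<le> B"
    using cadlag_bounded[OF assms(1)] by metis
  then show ?thesis
    using assms by (intro set_integrable_bounded[of _ _ _ B] cadlag_measurable) auto
qed

lemma set_integral_cells:
  fixes T :: real and n :: nat and F :: "real \<Rightarrow> 'a::{banach, second_countable_topology}"
  assumes "T > 0" "n > 0" and F: "set_integrable lborel {a<..a + T} F"
  shows "(LINT r:{a<..a + T}|lborel. F r) = (\<Sum>k<n. LINT r:{a + T * k / n<..a + T * Suc k / n}|lborel. F r)"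
proof -
  have "(LINT r:{a<..a + T * m / n}|lborel. F r) = (\<Sum>k<m. LINT r:{a + T * k / n<..a + T * Suc k / n}|lborel. F r)"
    if "m \<le> n" for m
    using that
  proof (induction m)
    case (Suc m)
    have le: "a \<le> a + T * m / n" "a + T * m / n \<le> a + T * Suc m / n" "a + T * Suc m / n \<le> a + T"
    proof -
      have "T * Suc m \<le> T * n" using assms Suc.prems by (intro mult_left_mono) auto
      then show "a + T * Suc m / n \<le> a + T" using assms by (simp add: pos_divide_le_eq)
    qed (use assms in \<open>auto intro!: divide_right_mono mult_left_mono\<close>)
    then have *: "{a<..a + T * Suc m / n} = {a<..a + T * m / n} \<union> {a + T * m / n<..a + T * Suc m / n}"
      by auto
    show ?case
      unfolding * using le Suc
      by (subst set_integral_Un) (auto intro!: set_integrable_subset[OF F])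
  qed (simp add: set_lebesgue_integral_def)
  from this[of n] show ?thesis using assms by simp
qed

lemma set_integral_Ioc_exp:
  fixes a b c :: real
  assumes "a \<le> b"
  shows "(LINT r:{a<..b}|lborel. c * exp (c * r)) = exp (c * b) - exp (c * a)"
proof -
  have "(LINT r:{a<..b}|lborel. c * exp (c * r)) = (LINT r:{a..b}|lborel. c * exp (c * r))"
  proof (rule set_integral_cong_set)
    show "AE x in lborel. (x \<in> {a..b}) = (x \<in> {a<..b})"
      using AE_lborel_singleton[of a] by eventually_elim (auto simp: less_le)
  qed (auto simp: set_borel_measurable_def)
  also have "\<dots> = exp (c * b) - exp (c * a)"
    unfolding set_lebesgue_integral_def using assms
    by (intro integral_FTC_atLeastAtMost)
       (auto intro!: derivative_eq_intros continuous_intros simp: has_real_derivative_iff_has_vector_derivative[symmetric])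
  finally show ?thesis .
qed

text \<open>A Riemann sum with left endpoints is the integral of a step function, and the step
  functions converge pointwise to \<open>g\<close> under a constant bound.\<close>

lemma riemann_sum_tendsto:
  fixes T :: real and g :: "real \<Rightarrow> 'a::{banach, second_countable_topology}"
  assumes T: "T > 0" and g: "continuous_on {0..T} g"
  shows "(\<lambda>m. \<Sum>k<Suc m. (T / Suc m) *\<^sub>R g (T * k / Suc m)) \<longlonglongrightarrow> (LINT r:{0<..T}|lborel. g r)"
proof -
  have "compact (g ` {0..T})" using g by (intro compact_continuous_image) auto
  then obtain B where "\<forall>x\<in>g ` {0..T}. norm x \<le> B"
    by (auto dest!: compact_imp_bounded simp only: bounded_iff)
  then have B: "norm (g r) \<le> B" if "0 \<le> r" "r \<le> T" for r using that by auto
  \<comment> \<open>The cells are half-open on the left, so rounding up gives the right endpoint of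
    the cell of \<open>r\<close> and subtracting the mesh gives its left endpoint.\<close>
  define \<gamma> where "\<gamma> m r = g (grid_up 0 T (Suc m) r - T / Suc m)" for m r
  have range: "0 \<le> grid_up 0 T (Suc m) r - T / Suc m" "grid_up 0 T (Suc m) r - T / Suc m \<le> T"
    if "0 < r" "r \<le> T" for m r
  proof -
    have "0 < \<lceil>r * real (Suc m) / T\<rceil>" using that T by auto
    then have "1 \<le> real_of_int \<lceil>r * real (Suc m) / T\<rceil>" by linarith
    then have "T / Suc m \<le> T * real_of_int \<lceil>r * real (Suc m) / T\<rceil> / Suc m"
      using T by (intro divide_right_mono) auto
    then show "0 \<le> grid_up 0 T (Suc m) r - T / Suc m" by (simp add: grid_up_def)
    show "grid_up 0 T (Suc m) r - T / Suc m \<le> T"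
      using grid_up_bounds(2)[OF T, where n="Suc m" and r=r and a=0] that by simp
  qed
  have [measurable]: "\<gamma> m \<in> borel_measurable borel" for m
    unfolding \<gamma>_def by (rule comp_grid_up_measurable[where f="\<lambda>x. g (x - T / Suc m)"])
  have int: "set_integrable lborel {0<..T} (\<gamma> m)" for m
    using range B by (intro set_integrable_bounded[of _ _ _ B])
       (auto simp: set_borel_measurable_def \<gamma>_def[symmetric], auto simp: \<gamma>_def)
  have "(\<Sum>k<Suc m. (T / Suc m) *\<^sub>R g (T * k / Suc m)) = (LINT r:{0<..T}|lborel. \<gamma> m r)" for m
  proof -
    have "(LINT r:{0<..T}|lborel. \<gamma> m r) = (\<Sum>k<Suc m. LINT r:{T * k / Suc m<..T * Suc k / Suc m}|lborel. \<gamma> m r)"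
      using set_integral_cells[of T "Suc m" 0 "\<gamma> m"] T int by simp
    also have "\<dots> = (\<Sum>k<Suc m. (T / Suc m) *\<^sub>R g (T * k / Suc m))"
    proof (rule sum.cong[OF refl])
      fix k
      have "(LINT r:{T * k / Suc m<..T * Suc k / Suc m}|lborel. \<gamma> m r) =
            (LINT r:{T * k / Suc m<..T * Suc k / Suc m}|lborel. g (T * k / Suc m))"
      proof (rule set_lebesgue_integral_cong, simp, safe)
        fix r assume "r \<in> {T * k / Suc m<..T * Suc k / Suc m}"
        then have "grid_up 0 T (Suc m) r = T * Suc k / Suc m"
          using grid_up_cell[of T "Suc m" 0 k r] T by simp
        then have "grid_up 0 T (Suc m) r - T / Suc m = T * k / Suc m"
          by (simp add: diff_divide_distrib[symmetric] distrib_left)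
        then show "\<gamma> m r = g (T * k / Suc m)" by (simp only: \<gamma>_def)
      qed
      also have "\<dots> = (T / Suc m) *\<^sub>R g (T * k / Suc m)"
      proof -
        have "T * Suc k / Suc m - T * k / Suc m = T / Suc m"
          by (simp add: diff_divide_distrib[symmetric] distrib_left)
        moreover have "T * k / Suc m \<le> T * Suc k / Suc m"
          using T by (intro divide_right_mono mult_left_mono) auto
        ultimately show ?thesis by (simp add: set_lebesgue_integral_def del: of_nat_Suc)
      qed
      finally show "(LINT r:{T * k / Suc m<..T * Suc k / Suc m}|lborel. \<gamma> m r) = (T / Suc m) *\<^sub>R g (T * k / Suc m)" .
    qed
    finally show ?thesis by simp
  qed
  moreover have "(\<lambda>m. LINT r:{0<..T}|lborel. \<gamma> m r) \<longlonglongrightarrow> (LINT r:{0<..T}|lborel. g r)"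
    unfolding set_lebesgue_integral_def
  proof (rule integral_dominated_convergence[where w="\<lambda>r. indicator {0<..T} r *\<^sub>R B"])
    have "set_borel_measurable borel {0<..T} g"
      unfolding set_borel_measurable_def
      by (intro borel_measurable_continuous_on_indicator continuous_on_subset[OF g]) auto
    then show "(\<lambda>r. indicator {0<..T} r *\<^sub>R g r) \<in> borel_measurable lborel"
      by (simp add: set_borel_measurable_def)
    show "AE r in lborel. (\<lambda>m. indicator {0<..T} r *\<^sub>R \<gamma> m r) \<longlonglongrightarrow> indicator {0<..T} r *\<^sub>R g r"
    proof (rule AE_I2)
      fix r
      show "(\<lambda>m. indicator {0<..T} r *\<^sub>R \<gamma> m r) \<longlonglongrightarrow> indicator {0<..T} r *\<^sub>R g r"
      proof (cases "r \<in> {0<..T}")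
        case True
        have "(\<lambda>m. grid_up 0 T (Suc m) r - T / real (Suc m)) \<longlonglongrightarrow> r - 0"
          by (intro tendsto_diff grid_up_tendsto T LIMSEQ_Suc lim_const_over_n)
        then have "(\<lambda>m. \<gamma> m r) \<longlonglongrightarrow> g r"
          unfolding \<gamma>_def using True range
          by (intro continuous_on_tendsto_compose[OF g]) (auto simp del: of_nat_Suc)
        then show ?thesis using True by simp
      qed simp
    qed
    show "AE r in lborel. norm (indicator {0<..T} r *\<^sub>R \<gamma> m r) \<le> indicator {0<..T} r *\<^sub>R B" for m
      using range B by (auto simp: indicator_def \<gamma>_def simp del: of_nat_Suc)
  qed (measurable, rule integrable_indicator_Ioc_scaleR)
  ultimately show ?thesis by simp
qed

text \<open>Pairing the left endpoint of each cell in the weights with the right endpoint in \<open>f\<close> leaves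
  a remainder that tends to zero by right continuity alone.\<close>

lemma OU_path_tendsto:
  fixes T c :: real and f l :: "real \<Rightarrow> 'a::{banach, second_countable_topology}"
  assumes f: "cadlag_on_nonneg f"
    and eq: "\<And>t. t \<ge> 0 \<Longrightarrow> f t = f 0 - c *\<^sub>R (LINT r:{0..t}|lborel. f r) + l t"
    and "a \<ge> 0" and "T \<ge> 0"
  shows "(\<lambda>m. \<Sum>k<Suc m. exp (- (c * (T - T * k / Suc m))) *\<^sub>R
            (l (a + T * Suc k / Suc m) - l (a + T * k / Suc m)))
         \<longlonglongrightarrow> f (a + T) - exp (- (c * T)) *\<^sub>R f a"
proof (cases "T = 0")
  case False
  then have T: "T > 0" using assms by simp
  have incr: "f v - f u = - c *\<^sub>R (LINT r:{u<..v}|lborel. f r) + (l v - l u)" if "0 \<le> u" "u \<le> v" for u v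
  proof -
    have Ioc: "(LINT r:{0..w}|lborel. f r) = (LINT r:{0<..w}|lborel. f r)" for w
    proof -
      have *: "AE x in lborel. indicator {0..w} x *\<^sub>R f x = indicator {0<..w} x *\<^sub>R f x"
        using AE_lborel_singleton[of 0] by eventually_elim (auto simp: indicator_def)
      \<comment> \<open>The equation integrates over closed intervals, the cells are half-open.
        \<open>integral_cong_AE\<close> wants both integrands measurable, and the closed version
        differs by the value at 0 alone.\<close>
      have **: "(\<lambda>r. indicator {0<..w} r *\<^sub>R f r) \<in> borel_measurable borel"
        using cadlag_measurable[OF f, of 0 w] by (simp add: set_borel_measurable_def)
      have "(\<lambda>r. indicator {0..w} r *\<^sub>R f r) =
          (\<lambda>r. indicator {0<..w} r *\<^sub>R f r + indicator {0} r *\<^sub>R (indicator {0..w} 0 *\<^sub>R f 0))"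
        by (auto simp: indicator_def fun_eq_iff)
      also have "\<dots> \<in> borel_measurable borel"
        by (intro borel_measurable_add ** borel_measurable_scaleR) auto
      finally show ?thesis unfolding set_lebesgue_integral_def
        using * ** by (intro integral_cong_AE) auto
    qed
    have "{0<..v} = {0<..u} \<union> {u<..v}" using that by auto
    then have "(LINT r:{0<..v}|lborel. f r) = (LINT r:{0<..u}|lborel. f r) + (LINT r:{u<..v}|lborel. f r)"
      using that by (simp only:) (intro set_integral_Un cadlag_set_integrable[OF f]; auto)
    then show ?thesis
      using eq[of u] eq[of v] that by (simp add: Ioc scaleR_add_right)
  qed
  define tau where "tau m k = a + T * real k / real (Suc m)" for m k
  have tau: "0 \<le> tau m k" "tau m k \<le> tau m (Suc k)" for m k
    using T \<open>a \<ge> 0\<close> by (auto simp: tau_def divide_simps)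
  have tau_ends: "tau m 0 = a" "tau m (Suc m) = a + T" for m
    by (auto simp: tau_def simp del: of_nat_Suc)
  \<comment> \<open>Integrating factor with a discrete product rule: for a cell from
    \<open>u\<close> to \<open>v\<close>, exp (c v) f v - exp (c u) f u = exp (c u) (f v - f u) +
    (exp (c v) - exp (c u)) f v. Inserting the equation for f v - f u leaves exp (c u) (l v - l u)
    plus the integral of \<open>G\<close> over the cell.\<close>
  define G where "G m r = (c * exp (c * r)) *\<^sub>R f (grid_up a T (Suc m) r)
      - (c * exp (c * (grid_up a T (Suc m) r - T / Suc m))) *\<^sub>R f r" for m r
  obtain B where B: "\<And>r. 0 \<le> r \<Longrightarrow> r \<le> a + T \<Longrightarrow> norm (f r) \<le> B"
    using cadlag_bounded[OF f] by metis
  define E where "E = exp (\<bar>c\<bar> * (a + 2 * T))"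
  have E: "exp (c * r) \<le> E" if "- T \<le> r" "r \<le> a + T" for r
  proof -
    have "c * r \<le> \<bar>c\<bar> * \<bar>r\<bar>" by (metis abs_ge_self abs_mult)
    also have "\<dots> \<le> \<bar>c\<bar> * (a + 2 * T)" using that T \<open>a \<ge> 0\<close> by (intro mult_left_mono) auto
    finally show ?thesis by (simp add: E_def)
  qed
  have gr: "r \<le> grid_up a T (Suc m) r" "grid_up a T (Suc m) r \<le> a + T"
      "r - T \<le> grid_up a T (Suc m) r - T / Suc m" "grid_up a T (Suc m) r - T / Suc m \<le> r" if "r \<le> a + T" for m r
  proof -
    have "T / Suc m \<le> T" using T by (simp add: field_simps)
    then show "r \<le> grid_up a T (Suc m) r" "grid_up a T (Suc m) r \<le> a + T"
      "r - T \<le> grid_up a T (Suc m) r - T / Suc m" "grid_up a T (Suc m) r - T / Suc m \<le> r"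
      using grid_up_bounds[OF T, where n="Suc m" and r=r and a=a] grid_up_le_end[OF T, of "Suc m" r a] that by simp_all
  qed
  have Gbound: "norm (G m r) \<le> \<bar>c\<bar> * E * B + \<bar>c\<bar> * E * B" if "a < r" "r \<le> a + T" for m r
  proof -
    have "norm (G m r) \<le> norm ((c * exp (c * r)) *\<^sub>R f (grid_up a T (Suc m) r)) +
       norm ((c * exp (c * (grid_up a T (Suc m) r - T / Suc m))) *\<^sub>R f r)"
      unfolding G_def by (rule norm_triangle_ineq4)
    also have "\<dots> \<le> \<bar>c\<bar> * E * B + \<bar>c\<bar> * E * B"
      unfolding norm_scaleR abs_mult abs_exp_cancel
      using that gr[of r m] T \<open>a \<ge> 0\<close>
      by (intro add_mono mult_mono E B) (auto simp: E_def)
    finally show ?thesis .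
  qed
  have Gm: "set_borel_measurable borel {a<..a + T} (G m)" for m
  proof -
    have [measurable]: "(\<lambda>r. indicator {a<..a + T} r *\<^sub>R f r) \<in> borel_measurable borel"
      using cadlag_measurable[OF f \<open>a \<ge> 0\<close>] by (simp add: set_borel_measurable_def)
    have "(\<lambda>r. indicator {a<..a + T} r *\<^sub>R G m r) =
       (\<lambda>r. indicator {a<..a + T} r *\<^sub>R ((c * exp (c * r)) *\<^sub>R f (grid_up a T (Suc m) r))
      - (c * exp (c * (grid_up a T (Suc m) r - T / Suc m))) *\<^sub>R (indicator {a<..a + T} r *\<^sub>R f r))"
      by (auto simp: G_def fun_eq_iff scaleR_diff_right)
    also have "\<dots> \<in> borel_measurable borel" by measurable
    finally show ?thesis by (simp add: set_borel_measurable_def)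
  qed
  have Gint: "set_integrable lborel {a<..a + T} (G m)" for m
    by (rule set_integrable_bounded[OF Gm Gbound])
  have step: "exp (c * tau m (Suc k)) *\<^sub>R f (tau m (Suc k)) - exp (c * tau m k) *\<^sub>R f (tau m k) =
      exp (c * tau m k) *\<^sub>R (l (tau m (Suc k)) - l (tau m k)) + (LINT r:{tau m k<..tau m (Suc k)}|lborel. G m r)"
    if "k < Suc m" for m k
  proof -
    have "(LINT r:{tau m k<..tau m (Suc k)}|lborel. G m r) =
      (LINT r:{tau m k<..tau m (Suc k)}|lborel. (c * exp (c * r)) *\<^sub>R f (tau m (Suc k))
         - (c * exp (c * tau m k)) *\<^sub>R f r)"
    proof (rule set_lebesgue_integral_cong, simp, safe)
      fix r assume "r \<in> {tau m k<..tau m (Suc k)}"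
      then have 1: "grid_up a T (Suc m) r = tau m (Suc k)"
        using grid_up_cell[of T "Suc m" a k r] T by (simp add: tau_def)
      have 2: "tau m (Suc k) - T / Suc m = tau m k"
        by (simp add: tau_def diff_divide_distrib[symmetric] right_diff_distrib[symmetric] add_diff_eq[symmetric] distrib_left)
      show "G m r = (c * exp (c * r)) *\<^sub>R f (tau m (Suc k)) - (c * exp (c * tau m k)) *\<^sub>R f r"
        unfolding G_def 1 2 ..
    qed
    also have "\<dots> = (LINT r:{tau m k<..tau m (Suc k)}|lborel. (c * exp (c * r)) *\<^sub>R f (tau m (Suc k)))
         - (LINT r:{tau m k<..tau m (Suc k)}|lborel. (c * exp (c * tau m k)) *\<^sub>R f r)"
    proof (rule set_integral_diff)
      have "set_integrable lborel {tau m k..tau m (Suc k)} (\<lambda>r. (c * exp (c * r)) *\<^sub>R f (tau m (Suc k)))"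
        unfolding set_integrable_def by (intro borel_integrable_compact continuous_intros compact_Icc)
      then show "set_integrable lborel {tau m k<..tau m (Suc k)} (\<lambda>r. (c * exp (c * r)) *\<^sub>R f (tau m (Suc k)))"
        by (rule set_integrable_subset) auto
    qed (intro set_integrable_scaleR_right impI cadlag_set_integrable f tau)
    also have "(LINT r:{tau m k<..tau m (Suc k)}|lborel. (c * exp (c * r)) *\<^sub>R f (tau m (Suc k))) =
        (LINT r:{tau m k<..tau m (Suc k)}|lborel. c * exp (c * r)) *\<^sub>R f (tau m (Suc k))"
    proof -
      have "set_integrable lborel {tau m k..tau m (Suc k)} (\<lambda>r. c * exp (c * r))"
        unfolding set_integrable_def by (intro borel_integrable_compact continuous_intros compact_Icc)
      then have "set_integrable lborel {tau m k<..tau m (Suc k)} (\<lambda>r. c * exp (c * r))"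
        by (rule set_integrable_subset) auto
      then show ?thesis
        unfolding set_lebesgue_integral_def set_integrable_def
        by (subst integral_scaleR_left[symmetric]) auto
    qed
    also have "(LINT r:{tau m k<..tau m (Suc k)}|lborel. (c * exp (c * tau m k)) *\<^sub>R f r) =
        exp (c * tau m k) *\<^sub>R (c *\<^sub>R (LINT r:{tau m k<..tau m (Suc k)}|lborel. f r))"
      by (simp add: mult.commute)
    also have "c *\<^sub>R (LINT r:{tau m k<..tau m (Suc k)}|lborel. f r) =
        (l (tau m (Suc k)) - l (tau m k)) - (f (tau m (Suc k)) - f (tau m k))"
      using incr[of "tau m k" "tau m (Suc k)"] tau[of m k] by simp
    finally show ?thesis
      unfolding set_integral_Ioc_exp[OF tau(2)] by (simp add: scaleR_diff_right scaleR_diff_left)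
  qed
  have total: "(\<Sum>k<Suc m. exp (c * tau m k) *\<^sub>R (l (tau m (Suc k)) - l (tau m k))) =
      exp (c * (a + T)) *\<^sub>R f (a + T) - exp (c * a) *\<^sub>R f a - (LINT r:{a<..a + T}|lborel. G m r)" for m
  proof -
    have "exp (c * (a + T)) *\<^sub>R f (a + T) - exp (c * a) *\<^sub>R f a =
        (\<Sum>k<Suc m. exp (c * tau m (Suc k)) *\<^sub>R f (tau m (Suc k)) - exp (c * tau m k) *\<^sub>R f (tau m k))"
      by (subst sum_lessThan_telescope) (simp add: tau_ends)
    also have "\<dots> = (\<Sum>k<Suc m. exp (c * tau m k) *\<^sub>R (l (tau m (Suc k)) - l (tau m k))) +
        (\<Sum>k<Suc m. LINT r:{tau m k<..tau m (Suc k)}|lborel. G m r)"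
      unfolding sum.distrib[symmetric] by (intro sum.cong refl step) simp
    also have "(\<Sum>k<Suc m. LINT r:{tau m k<..tau m (Suc k)}|lborel. G m r) = (LINT r:{a<..a + T}|lborel. G m r)"
      using set_integral_cells[OF T _ Gint, of "Suc m" m] by (simp add: tau_def)
    finally show ?thesis by simp
  qed
  have "(\<lambda>m. LINT r:{a<..a + T}|lborel. G m r) \<longlonglongrightarrow> (LINT r:{a<..a + T}|lborel. 0)"
    unfolding set_lebesgue_integral_def
  proof (rule integral_dominated_convergence[where w="\<lambda>r. indicator {a<..a + T} r *\<^sub>R (\<bar>c\<bar> * E * B + \<bar>c\<bar> * E * B)"])
    show "(\<lambda>r. indicator {a<..a + T} r *\<^sub>R G m r) \<in> borel_measurable lborel" for m
      using Gm by (simp add: set_borel_measurable_def)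
    show "AE r in lborel. (\<lambda>m. indicator {a<..a + T} r *\<^sub>R G m r) \<longlonglongrightarrow> indicator {a<..a + T} r *\<^sub>R 0"
    proof (rule AE_I2)
      fix r
      show "(\<lambda>m. indicator {a<..a + T} r *\<^sub>R G m r) \<longlonglongrightarrow> indicator {a<..a + T} r *\<^sub>R 0"
      proof (cases "r \<in> {a<..a + T}")
        case True
        have conv: "(\<lambda>m. grid_up a T (Suc m) r - T / real (Suc m)) \<longlonglongrightarrow> r - 0"
          by (intro tendsto_diff grid_up_tendsto T LIMSEQ_Suc lim_const_over_n)
        \<comment> \<open>Both terms of \<open>G\<close> have the same limit: the value of
          \<open>f\<close> at the right endpoint converges by right continuity, and the left
          endpoint enters only through the continuous exponential.\<close>
        have "(\<lambda>m. G m r) \<longlonglongrightarrow> (c * exp (c * r)) *\<^sub>R f r - (c * exp (c * (r - 0))) *\<^sub>R f r"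
          unfolding G_def using True \<open>a \<ge> 0\<close>
          by (intro tendsto_diff[OF _ tendsto_scaleR] tendsto_scaleR tendsto_mult tendsto_exp tendsto_const
                cadlag_grid_up f T conv) auto
        then show ?thesis using True by simp
      qed simp
    qed
    show "AE r in lborel. norm (indicator {a<..a + T} r *\<^sub>R G m r) \<le>
        indicator {a<..a + T} r *\<^sub>R (\<bar>c\<bar> * E * B + \<bar>c\<bar> * E * B)" for m
      using Gbound by (auto simp: indicator_def)
  qed (simp, rule integrable_indicator_Ioc_scaleR)
  then have "(\<lambda>m. \<Sum>k<Suc m. exp (c * tau m k) *\<^sub>R (l (tau m (Suc k)) - l (tau m k))) \<longlonglongrightarrow>
      exp (c * (a + T)) *\<^sub>R f (a + T) - exp (c * a) *\<^sub>R f a - 0"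
    unfolding total by (intro tendsto_diff tendsto_const) (simp add: set_lebesgue_integral_def)
  then have "(\<lambda>m. exp (- (c * (a + T))) *\<^sub>R (\<Sum>k<Suc m. exp (c * tau m k) *\<^sub>R (l (tau m (Suc k)) - l (tau m k)))) \<longlonglongrightarrow>
      exp (- (c * (a + T))) *\<^sub>R (exp (c * (a + T)) *\<^sub>R f (a + T) - exp (c * a) *\<^sub>R f a - 0)"
    by (intro tendsto_scaleR tendsto_const)
  moreover have "exp (- (c * (a + T))) *\<^sub>R (\<Sum>k<Suc m. exp (c * tau m k) *\<^sub>R (l (tau m (Suc k)) - l (tau m k))) =
      (\<Sum>k<Suc m. exp (- (c * (T - T * k / Suc m))) *\<^sub>R (l (a + T * Suc k / Suc m) - l (a + T * k / Suc m)))" for m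
    unfolding scaleR_sum_right scaleR_scaleR exp_add[symmetric]
    by (intro sum.cong refl) (simp add: tau_def algebra_simps)
  moreover have "exp (- (c * (a + T))) *\<^sub>R (exp (c * (a + T)) *\<^sub>R f (a + T) - exp (c * a) *\<^sub>R f a - 0) =
      f (a + T) - exp (- (c * T)) *\<^sub>R f a"
    by (simp add: scaleR_diff_right exp_add[symmetric] algebra_simps)
  ultimately show ?thesis by simp
qed simp

section \<open>Characteristic functions of Levy and Ornstein--Uhlenbeck processes\<close>

lemma char_fun_distr:
  assumes "X \<in> borel_measurable M"
  shows "char_fun (distr M borel X) z = (LINT \<omega>|M. iexp (X \<omega> \<bullet> z))"
  using assms unfolding char_fun_def by (subst integral_distr) auto

lemma (in finite_measure) integrable_iexp_inner:
  assumes [measurable]: "f \<in> borel_measurable M"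
  shows "integrable M (\<lambda>x. iexp (f x))"
  by (rule integrable_const_bound[where B=1]) auto

lemma (in finite_measure) iexp_tendsto:
  assumes [measurable]: "\<And>n. X n \<in> borel_measurable M" "Y \<in> borel_measurable M"
    and "AE \<omega> in M. (\<lambda>n. X n \<omega>) \<longlonglongrightarrow> Y \<omega>"
  shows "(\<lambda>n. LINT \<omega>|M. iexp (X n \<omega>)) \<longlonglongrightarrow> (LINT \<omega>|M. iexp (Y \<omega>))"
proof (rule integral_dominated_convergence[where w="\<lambda>_. 1"])
  show "AE \<omega> in M. (\<lambda>n. iexp (X n \<omega>)) \<longlonglongrightarrow> iexp (Y \<omega>)"
    using assms(3) by eventually_elim (intro tendsto_intros)
qed auto

lemma continuous_on_char_fun:
  fixes \<mu> :: "'a::euclidean_space measure"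
  assumes "finite_measure \<mu>" and [measurable_cong]: "sets \<mu> = sets borel"
  shows "continuous_on S (char_fun \<mu>)"
proof (rule continuous_on_sequentiallyI)
  fix u :: "nat \<Rightarrow> 'a" and a assume "u \<longlonglongrightarrow> a"
  then show "(\<lambda>n. char_fun \<mu> (u n)) \<longlonglongrightarrow> char_fun \<mu> a"
    unfolding char_fun_def
    by (intro finite_measure.iexp_tendsto assms AE_I2 tendsto_intros) auto
qed

text \<open>A continuous map from a connected space into the finite set of \<open>n\<close>-th roots
  of unity is constant. It selects the right \<open>n\<close>-th root of a characteristic
  function.\<close>

lemma constant_if_roots_of_unity:
  fixes q :: "'a::real_normed_vector \<Rightarrow> complex"
  assumes "continuous_on UNIV q" "n > 0" "\<And>z. q z ^ n = 1" "q 0 = 1"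
  shows "q z = 1"
proof -
  have "range q \<subseteq> {w. w ^ n = 1}" using assms(3) by auto
  then have "finite (range q)"
    by (rule finite_subset) (use assms(2) in \<open>auto intro!: finite_roots_unity\<close>)
  then have "q constant_on UNIV"
    using assms(1) by (intro continuous_finite_range_constant) auto
  then show ?thesis using assms(4) by (auto simp: constant_on_def)
qed

locale levy = prob_space M for M :: "'w measure" +
  fixes L :: "real \<Rightarrow> 'w \<Rightarrow> 'a::euclidean_space"
  assumes levy: "levy_process M L"
begin

lemma rv [measurable]: "t \<ge> 0 \<Longrightarrow> L t \<in> borel_measurable M"
  using levy by (auto simp: levy_process_def)

abbreviation phi :: "real \<Rightarrow> 'a \<Rightarrow> complex" where
  "phi t \<equiv> char_fun (distr M borel (L t))"

lemma char_increment:
  assumes "0 \<le> s" "s \<le> t"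
  shows "(LINT \<omega>|M. iexp ((L t \<omega> - L s \<omega>) \<bullet> z)) = phi (t - s) z"
proof -
  have [measurable]: "L s \<in> borel_measurable M" "L t \<in> borel_measurable M" using assms by auto
  have "distr M borel (\<lambda>\<omega>. L (s + (t - s)) \<omega> - L s \<omega>) = distr M borel (L (t - s))"
    using levy assms unfolding levy_process_def by (meson diff_ge_0_iff_ge)
  then have "char_fun (distr M borel (\<lambda>\<omega>. L t \<omega> - L s \<omega>)) z = phi (t - s) z" by simp
  then show ?thesis by (subst (asm) char_fun_distr) auto
qed

lemma char_increments:
  fixes \<tau> :: "nat \<Rightarrow> real" and a :: "nat \<Rightarrow> 'a"
  assumes "0 \<le> \<tau> 0" "\<And>k. k < n \<Longrightarrow> \<tau> k < \<tau> (Suc k)"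
  shows "(LINT \<omega>|M. iexp (\<Sum>k<n. (L (\<tau> (Suc k)) \<omega> - L (\<tau> k) \<omega>) \<bullet> a k)) =
         (\<Prod>k<n. phi (\<tau> (Suc k) - \<tau> k) (a k))"
proof -
  have pos: "0 \<le> \<tau> k" if "k \<le> n" for k
    using that by (induction k) (use assms in \<open>auto simp: Suc_le_eq intro: order_trans less_imp_le\<close>)
  have ind: "indep_vars (\<lambda>_. borel) (\<lambda>k \<omega>. L (\<tau> (Suc k)) \<omega> - L (\<tau> k) \<omega>) {..<n}"
    using levy assms unfolding levy_process_def by blast
  have ind': "indep_vars (\<lambda>_. borel) (\<lambda>k \<omega>. iexp ((L (\<tau> (Suc k)) \<omega> - L (\<tau> k) \<omega>) \<bullet> a k)) {..<n}"
    by (rule indep_vars_compose2[OF ind]) measurable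
  have meas: "(\<lambda>\<omega>. (L (\<tau> (Suc k)) \<omega> - L (\<tau> k) \<omega>) \<bullet> a k) \<in> borel_measurable M" if "k < n" for k
    using pos[of k] pos[of "Suc k"] that by (intro borel_measurable_inner borel_measurable_diff rv) auto
  have "(LINT \<omega>|M. iexp (\<Sum>k<n. (L (\<tau> (Suc k)) \<omega> - L (\<tau> k) \<omega>) \<bullet> a k)) =
        (LINT \<omega>|M. (\<Prod>k<n. iexp ((L (\<tau> (Suc k)) \<omega> - L (\<tau> k) \<omega>) \<bullet> a k)))"
    by (simp add: sum_distrib_left exp_sum)
  also have "\<dots> = (\<Prod>k<n. (LINT \<omega>|M. iexp ((L (\<tau> (Suc k)) \<omega> - L (\<tau> k) \<omega>) \<bullet> a k)))"
    by (intro indep_vars_lebesgue_integral ind' integrable_iexp_inner meas) auto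
  also have "\<dots> = (\<Prod>k<n. phi (\<tau> (Suc k) - \<tau> k) (a k))"
    using pos assms(2) by (intro prod.cong refl char_increment) (auto simp: less_imp_le)
  finally show ?thesis .
qed

lemma AE_cadlag: "AE \<omega> in M. cadlag_on_nonneg (\<lambda>t. L t \<omega>)"
  using levy by (auto simp: levy_process_def)

lemma phi_mult:
  assumes "h > 0"
  shows "phi (real n * h) z = phi h z ^ n"
proof -
  have [measurable]: "L (real n * h) \<in> borel_measurable M" using assms by auto
  have "phi (real n * h) z = (LINT \<omega>|M. iexp ((L (real n * h) \<omega> - L 0 \<omega>) \<bullet> z))"
    using char_increment[of 0 "real n * h" z] assms by simp
  also have "\<dots> = (LINT \<omega>|M. iexp (\<Sum>k<n. (L (real (Suc k) * h) \<omega> - L (real k * h) \<omega>) \<bullet> z))"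
    by (simp only: inner_sum_left[symmetric] sum_lessThan_telescope[of "\<lambda>k. L (real k * h) _"]) simp
  also have "\<dots> = (\<Prod>k<n. phi (real (Suc k) * h - real k * h) z)"
    using assms by (intro char_increments[where \<tau>="\<lambda>k. real k * h"]) auto
  also have "\<dots> = phi h z ^ n" by (simp add: algebra_simps)
  finally show ?thesis .
qed

text \<open>For \<open>h = 1 / n\<close> the quotient of the two sides is a continuous root of unity
  with value 1 at frequency 0, hence 1. \<open>phi_mult\<close> extends the formula to rational
  times and right continuity of the paths to all \<open>h\<close>.\<close>

lemma phi_eq:
  assumes c: "continuous_on UNIV c" "c 0 = 0" and one: "\<And>z. phi 1 z = exp (c z)" and "h \<ge> 0"
  shows "phi h z = exp (h * c z)"
proof -
  have inv: "phi (1 / real n) z = exp (c z / n)" if n: "n > 0" for n z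
  proof -
    have [measurable]: "L (1 / n) \<in> borel_measurable M" by auto
    have "phi (1 / real n) z / exp (c z / n) = 1"
    proof (rule constant_if_roots_of_unity[where n=n and z=z and
          q="\<lambda>z. phi (1 / real n) z / exp (c z / of_nat n)"])
      show "continuous_on UNIV (\<lambda>z. phi (1 / real n) z / exp (c z / of_nat n))"
        using n by (intro continuous_intros continuous_on_char_fun c finite_measure_distr) auto
      show "(phi (1 / real n) z / exp (c z / of_nat n)) ^ n = 1" for z
      proof -
        have "phi (1 / real n) z ^ n = exp (c z)" using n phi_mult[of "1 / real n" n z] one[of z] by simp
        then show ?thesis using n by (simp only: power_divide exp_of_nat_mult[symmetric]) simp
      qed
      show "phi (1 / real n) 0 / exp (c 0 / of_nat n) = 1"
        using c by (simp add: char_fun_distr prob_space)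
    qed (rule n)
    then show ?thesis by simp
  qed
  \<comment> \<open>\<open>h\<close> rounded up to a multiple of \<open>1 / Suc m\<close>: a
    rational time converging to \<open>h\<close> from the right.\<close>
  define g where "g m = grid_up 0 1 (Suc m) h" for m
  have g: "phi (g m) z = exp (g m * c z)" for m
  proof -
    define j where "j = nat \<lceil>h * real (Suc m)\<rceil>"
    have "0 \<le> h * real (Suc m)" using \<open>h \<ge> 0\<close> by simp
    then have "0 \<le> \<lceil>h * real (Suc m)\<rceil>" by linarith
    then have gj: "g m = real j * (1 / real (Suc m))" by (simp add: g_def grid_up_def j_def)
    show ?thesis
      unfolding gj by (subst phi_mult) (simp_all add: inv exp_of_nat_mult[symmetric] del: of_nat_Suc)
  qed
  have "(\<lambda>m. phi (g m) z) \<longlonglongrightarrow> phi h z"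
  proof -
    have g0: "g m \<ge> 0" for m using grid_up_bounds(1)[of 1 "Suc m" h 0] \<open>h \<ge> 0\<close> by (simp add: g_def)
    show ?thesis
      using \<open>h \<ge> 0\<close> g0 unfolding g_def
    proof (subst (1 2) char_fun_distr, auto intro!: iexp_tendsto)
      show "AE \<omega> in M. (\<lambda>n. L (grid_up 0 1 (Suc n) h) \<omega> \<bullet> z) \<longlonglongrightarrow> L h \<omega> \<bullet> z"
        using AE_cadlag
      proof eventually_elim
        case (elim \<omega>)
        show ?case
          by (intro tendsto_inner tendsto_const cadlag_grid_up[OF elim]) (use \<open>h \<ge> 0\<close> in auto)
      qed
    qed
  qed
  moreover have "(\<lambda>m. phi (g m) z) \<longlonglongrightarrow> exp (h * c z)"
    unfolding g unfolding g_def by (intro tendsto_intros grid_up_tendsto) auto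
  ultimately show ?thesis by (rule LIMSEQ_unique)
qed

end

section \<open>Independence and the joint characteristic function of the process\<close>

lemma (in prob_space) indep_set_imp_indep_var:
  assumes ind: "indep_set (sets F) (sets G)" and sp: "space F = space M" "space G = space M"
    and X: "X \<in> F \<rightarrow>\<^sub>M S" and Y: "Y \<in> G \<rightarrow>\<^sub>M T"
  shows "indep_var S X T Y"
  unfolding indep_var_eq
proof (intro conjI)
  have sub: "sets F \<subseteq> events" "sets G \<subseteq> events" using ind by (auto simp: indep_sets2_eq)
  show "X \<in> M \<rightarrow>\<^sub>M S" "Y \<in> M \<rightarrow>\<^sub>M T"
    using X Y sub sp by (auto simp: measurable_def)
  have "sigma_sets (space M) {X -` A \<inter> space M |A. A \<in> sets S} \<subseteq> sets F"
    using X unfolding sp(1)[symmetric] by (intro sets.sigma_sets_subset) (auto dest: measurable_sets)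
  moreover have "sigma_sets (space M) {Y -` A \<inter> space M |A. A \<in> sets T} \<subseteq> sets G"
    using Y unfolding sp(2)[symmetric] by (intro sets.sigma_sets_subset) (auto dest: measurable_sets)
  ultimately show "indep_set (sigma_sets (space M) {X -` A \<inter> space M |A. A \<in> sets S})
     (sigma_sets (space M) {Y -` A \<inter> space M |A. A \<in> sets T})"
    using ind unfolding indep_sets2_eq by blast
qed

text \<open>\<open>OU_process\<close> states independence of \<open>Y 0\<close> and the driving path
  through generated sigma-algebras. This form splits off \<open>Y 0\<close> from any sum of
  increments measurable with respect to the path.\<close>

lemma (in prob_space) indep_set_iexp_mult:
  assumes ind: "indep_set (sets F) (sets G)" and sp: "space F = space M" "space G = space M"
    and X: "X \<in> borel_measurable F" and S: "S \<in> borel_measurable G"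
  shows "(LINT \<omega>|M. iexp (X \<omega> + S \<omega>)) = (LINT \<omega>|M. iexp (X \<omega>)) * (LINT \<omega>|M. iexp (S \<omega>))"
proof -
  have "indep_var borel X borel S" by (rule indep_set_imp_indep_var[OF assms])
  then have [measurable]: "X \<in> borel_measurable M" "S \<in> borel_measurable M"
    by (auto dest: indep_var_rv1 indep_var_rv2)
  have "indep_var borel (\<lambda>\<omega>. iexp (X \<omega>)) borel (\<lambda>\<omega>. iexp (S \<omega>))"
    by (intro indep_set_imp_indep_var[OF ind sp] measurable_compose[OF X] measurable_compose[OF S]) measurable
  from indep_var_lebesgue_integral[OF this] show ?thesis
    by (simp add: integrable_iexp_inner distrib_left exp_add)
qed

lemma sum_lessThan_split:
  fixes f :: "nat \<Rightarrow> 'b::comm_monoid_add"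
  shows "sum f {..<m + n} = sum f {..<m} + (\<Sum>k<n. f (m + k))"
proof (induction n)
  case (Suc n)
  then show ?case by (simp only: add_Suc_right sum.lessThan_Suc add.assoc)
qed simp

context levy
begin

abbreviation path_algebra :: "'w measure" where
  "path_algebra \<equiv> vimage_algebra (space M) (\<lambda>\<omega>. \<lambda>t\<in>{0..}. L t \<omega>) (\<Pi>\<^sub>M t\<in>{0..}. borel)"

lemma rv_path_algebra: "t \<ge> 0 \<Longrightarrow> L t \<in> borel_measurable path_algebra"
proof -
  assume "t \<ge> 0"
  have 1: "(\<lambda>\<omega>. \<lambda>t\<in>{0..}. L t \<omega>) \<in> path_algebra \<rightarrow>\<^sub>M (\<Pi>\<^sub>M t\<in>{0..}. borel)"
    by (intro measurable_vimage_algebra1) (auto simp: space_PiM)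
  have 2: "(\<lambda>x. x t) \<in> (\<Pi>\<^sub>M t\<in>{0..}. borel) \<rightarrow>\<^sub>M (borel :: 'a measure)"
    using \<open>t \<ge> 0\<close> by (intro measurable_component_singleton) auto
  show ?thesis using measurable_compose[OF 1 2] \<open>t \<ge> 0\<close> by simp
qed

text \<open>\<open>Y s\<close> minus the decayed \<open>Y 0\<close> is a limit of sums of increments
  over [0, s], and the difference of the left-hand side is one over [s, s + t]. These increments and
  \<open>Y 0\<close> are independent, so the characteristic function is a product before the limit,
  and the exponents are Riemann sums. At \<open>w = 0\<close> the last factor disappears, which
  identifies the other two as the characteristic function of \<open>Y s\<close>.\<close>

lemma OU_joint_char:
  assumes OU: "OU_process M rate L Y"
    and c: "continuous_on UNIV c" "c 0 = 0" and one: "\<And>z. phi 1 z = exp (c z)"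
    and s: "s \<ge> 0" and t: "t > 0"
  shows "(LINT \<omega>|M. iexp (Y s \<omega> \<bullet> z + (Y (s + t) \<omega> - exp (- (rate * t)) *\<^sub>R Y s \<omega>) \<bullet> w)) =
     char_fun (distr M borel (Y 0)) (exp (- (rate * s)) *\<^sub>R z) *
     exp (LINT r:{0<..s}|lborel. c (exp (- (rate * (s - r))) *\<^sub>R z)) *
     exp (LINT r:{0<..t}|lborel. c (exp (- (rate * (t - r))) *\<^sub>R w))"
proof -
  have Yrv [measurable]: "u \<ge> 0 \<Longrightarrow> Y u \<in> borel_measurable M" for u
    using OU by (auto simp: OU_process_def)
  have ind: "indep_set (sets (vimage_algebra (space M) (Y 0) borel)) (sets path_algebra)"
    using OU by (simp add: OU_process_def)
  have path: "AE \<omega> in M. cadlag_on_nonneg (\<lambda>t. Y t \<omega>) \<and>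
        (\<forall>t\<ge>0. Y t \<omega> = Y 0 \<omega> - rate *\<^sub>R (LINT r:{0..t}|lborel. Y r \<omega>) + L t \<omega>)"
    using OU by (simp add: OU_process_def)
  let ?v = "exp (- (rate * s)) *\<^sub>R z"
  define S where "S a T m \<omega> = (\<Sum>k<Suc m. exp (- (rate * (T - T * k / Suc m))) *\<^sub>R
            (L (a + T * Suc k / Suc m) \<omega> - L (a + T * k / Suc m) \<omega>))" for a T :: real and m \<omega>
  have S_meas: "(\<lambda>\<omega>. S a T m \<omega> \<bullet> z) \<in> borel_measurable path_algebra" if "a \<ge> 0" "T \<ge> 0" for a T m z
    unfolding S_def using that
    by (intro borel_measurable_inner borel_measurable_sum borel_measurable_scaleR borel_measurable_diff
        borel_measurable_const rv_path_algebra) auto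
  have S_meas' [measurable]: "S a T m \<in> borel_measurable M" if "a \<ge> 0" "T \<ge> 0" for a T m
    unfolding S_def using that
    by (intro borel_measurable_sum borel_measurable_scaleR borel_measurable_diff borel_measurable_const rv) auto
  have S_char: "(LINT \<omega>|M. iexp (S 0 s m \<omega> \<bullet> z + S s t m \<omega> \<bullet> w)) =
      exp (\<Sum>k<Suc m. (s / Suc m) *\<^sub>R c (exp (- (rate * (s - s * k / Suc m))) *\<^sub>R z)) *
      exp (\<Sum>k<Suc m. (t / Suc m) *\<^sub>R c (exp (- (rate * (t - t * k / Suc m))) *\<^sub>R w))" for m
  proof -
    define n where "n = Suc m"
    have n: "n > 0" by (simp add: n_def)
    \<comment> \<open>\<open>char_increments\<close> demands strictly increasing times. For
      \<open>s = 0\<close> the first block would repeat the time 0, so it is dropped; all its terms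
      vanish, which is what the fact \<open>m0\<close> below uses to restore the sum over
      \<open>n\<close> cells.\<close>
    define m0 where "m0 = (if s = 0 then 0 else n)"
    define \<tau> where "\<tau> k = (if k < m0 then s * real k / n else s + t * real (k - m0) / n)" for k
    define a where "a k = (if k < m0 then exp (- (rate * (s - s * k / n))) *\<^sub>R z
        else exp (- (rate * (t - t * real (k - m0) / n))) *\<^sub>R w)" for k
    \<comment> \<open>The formula of the first block also holds at \<open>k = m0\<close>, where both
      branches give \<open>s\<close>; so the last increment of that block ends where the second
      block starts.\<close>
    have \<tau>1: "\<tau> k = 0 + s * real k / n" if "k \<le> m0" for k
      using that n by (auto simp: \<tau>_def m0_def split: if_splits)
    have \<tau>2: "\<tau> (m0 + k) = s + t * real k / n" for k by (simp add: \<tau>_def)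
    have d1: "\<tau> (Suc k) - \<tau> k = s / n" if "k < m0" for k
      using that n \<tau>1[of k] \<tau>1[of "Suc k"]
      by (simp add: diff_divide_distrib[symmetric] distrib_left)
    have d2: "\<tau> (Suc (m0 + k)) - \<tau> (m0 + k) = t / n" for k
      using \<tau>2[of k] \<tau>2[of "Suc k"] by (simp add: diff_divide_distrib[symmetric] distrib_left)
    have mono: "\<tau> k < \<tau> (Suc k)" for k
    proof (cases "k < m0")
      case True
      then have "s > 0" using s by (auto simp: m0_def split: if_splits)
      then have "0 < s / n" using n by simp
      then show ?thesis using d1[OF True] by linarith
    next
      case False
      have "0 < t / n" using n t by simp
      then show ?thesis using d2[of "k - m0"] False by simp
    qed
    have \<tau>0: "0 \<le> \<tau> 0" using s by (auto simp: \<tau>_def)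
    have m0: "(\<Sum>k<m0. g k) = (\<Sum>k<n. g k)" if "s = 0 \<Longrightarrow> (\<And>k. g k = 0)" for g :: "nat \<Rightarrow> 'z::comm_monoid_add"
      using that by (auto simp: m0_def)
    have sum: "S 0 s m \<omega> \<bullet> z + S s t m \<omega> \<bullet> w = (\<Sum>k<m0 + n. (L (\<tau> (Suc k)) \<omega> - L (\<tau> k) \<omega>) \<bullet> a k)" for \<omega>
    proof -
      have "(\<Sum>k<m0. (L (\<tau> (Suc k)) \<omega> - L (\<tau> k) \<omega>) \<bullet> a k) =
          (\<Sum>k<m0. (L (0 + s * real (Suc k) / n) \<omega> - L (0 + s * real k / n) \<omega>) \<bullet> (exp (- (rate * (s - s * k / n))) *\<^sub>R z))"
        by (intro sum.cong refl) (simp add: \<tau>1 a_def)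
      also have "\<dots> = (\<Sum>k<n. (L (0 + s * real (Suc k) / n) \<omega> - L (0 + s * real k / n) \<omega>) \<bullet> (exp (- (rate * (s - s * k / n))) *\<^sub>R z))"
        by (rule m0) simp
      also have "\<dots> = S 0 s m \<omega> \<bullet> z"
        unfolding S_def n_def by (simp only: inner_sum_left inner_scaleR_left inner_scaleR_right)
      finally have 1: "(\<Sum>k<m0. (L (\<tau> (Suc k)) \<omega> - L (\<tau> k) \<omega>) \<bullet> a k) = S 0 s m \<omega> \<bullet> z" .
      have "(\<Sum>k<n. (L (\<tau> (Suc (m0 + k))) \<omega> - L (\<tau> (m0 + k)) \<omega>) \<bullet> a (m0 + k)) = S s t m \<omega> \<bullet> w"
        unfolding S_def n_def[symmetric] inner_sum_left
        by (intro sum.cong refl, subst add_Suc_right[symmetric])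
           (simp only: \<tau>2, simp add: a_def)
      with 1 show ?thesis by (simp add: sum_lessThan_split)
    qed
    have "(LINT \<omega>|M. iexp (S 0 s m \<omega> \<bullet> z + S s t m \<omega> \<bullet> w)) = (\<Prod>k<m0 + n. phi (\<tau> (Suc k) - \<tau> k) (a k))"
      unfolding sum using \<tau>0 mono by (intro char_increments)
    also have "\<dots> = (\<Prod>k<m0 + n. exp ((\<tau> (Suc k) - \<tau> k) *\<^sub>R c (a k)))"
      using mono by (intro prod.cong refl)
        (simp add: phi_eq[OF c one] less_imp_le scaleR_conv_of_real del: of_real_diff)
    also have "\<dots> = exp (\<Sum>k<m0 + n. (\<tau> (Suc k) - \<tau> k) *\<^sub>R c (a k))"
      by (simp add: exp_sum)
    also have "(\<Sum>k<m0 + n. (\<tau> (Suc k) - \<tau> k) *\<^sub>R c (a k)) =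
       (\<Sum>k<m0. (s / n) *\<^sub>R c (exp (- (rate * (s - s * k / n))) *\<^sub>R z)) +
       (\<Sum>k<n. (t / n) *\<^sub>R c (exp (- (rate * (t - t * k / n))) *\<^sub>R w))"
      unfolding sum_lessThan_split
      by (intro arg_cong2[where f="(+)"] sum.cong refl) (simp_all only: d1 d2 lessThan_iff, simp_all add: a_def)
    also have "(\<Sum>k<m0. (s / n) *\<^sub>R c (exp (- (rate * (s - s * k / n))) *\<^sub>R z)) =
       (\<Sum>k<n. (s / n) *\<^sub>R c (exp (- (rate * (s - s * k / n))) *\<^sub>R z))"
      by (rule m0) simp
    finally show ?thesis unfolding exp_add n_def .
  qed
  define X where "X m \<omega> = Y 0 \<omega> \<bullet> ?v + (S 0 s m \<omega> \<bullet> z + S s t m \<omega> \<bullet> w)" for m \<omega>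
  have X_char: "(LINT \<omega>|M. iexp (X m \<omega>)) = char_fun (distr M borel (Y 0)) ?v *
      (LINT \<omega>|M. iexp (S 0 s m \<omega> \<bullet> z + S s t m \<omega> \<bullet> w))" for m
  proof -
    have "(\<lambda>\<omega>. Y 0 \<omega> \<bullet> ?v) \<in> borel_measurable (vimage_algebra (space M) (Y 0) borel)"
      by (intro borel_measurable_inner measurable_vimage_algebra1 borel_measurable_const) auto
    moreover have "(\<lambda>\<omega>. S 0 s m \<omega> \<bullet> z + S s t m \<omega> \<bullet> w) \<in> borel_measurable path_algebra"
      using s t by (intro borel_measurable_add S_meas) auto
    ultimately show ?thesis
      unfolding X_def char_fun_distr[OF Yrv[OF order_refl]]
      by (rule indep_set_iexp_mult[OF ind space_vimage_algebra space_vimage_algebra])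
  qed
  have "(\<lambda>m. LINT \<omega>|M. iexp (X m \<omega>)) \<longlonglongrightarrow>
      (LINT \<omega>|M. iexp (Y s \<omega> \<bullet> z + (Y (s + t) \<omega> - exp (- (rate * t)) *\<^sub>R Y s \<omega>) \<bullet> w))"
  proof (rule iexp_tendsto)
    have [measurable]: "Y 0 \<in> borel_measurable M" "Y s \<in> borel_measurable M" "Y (s + t) \<in> borel_measurable M"
      "S 0 s m \<in> borel_measurable M" "S s t m \<in> borel_measurable M" for m
      using s t by (simp_all add: Yrv S_meas')
    show "X m \<in> borel_measurable M" for m unfolding X_def by measurable
    show "(\<lambda>\<omega>. Y s \<omega> \<bullet> z + (Y (s + t) \<omega> - exp (- (rate * t)) *\<^sub>R Y s \<omega>) \<bullet> w) \<in> borel_measurable M" by measurable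
    show "AE \<omega> in M. (\<lambda>m. X m \<omega>) \<longlonglongrightarrow> Y s \<omega> \<bullet> z + (Y (s + t) \<omega> - exp (- (rate * t)) *\<^sub>R Y s \<omega>) \<bullet> w"
      using path
    proof eventually_elim
      case (elim \<omega>)
      then have cad: "cadlag_on_nonneg (\<lambda>t. Y t \<omega>)"
        and eq: "\<And>t. t \<ge> 0 \<Longrightarrow> Y t \<omega> = Y 0 \<omega> - rate *\<^sub>R (LINT r:{0..t}|lborel. Y r \<omega>) + L t \<omega>"
        by blast+
      have 1: "(\<lambda>m. S 0 s m \<omega>) \<longlonglongrightarrow> Y s \<omega> - exp (- (rate * s)) *\<^sub>R Y 0 \<omega>"
        using OU_path_tendsto[OF cad eq order_refl s] unfolding S_def by simp
      have 2: "(\<lambda>m. S s t m \<omega>) \<longlonglongrightarrow> Y (s + t) \<omega> - exp (- (rate * t)) *\<^sub>R Y s \<omega>"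
        using OU_path_tendsto[OF cad eq s less_imp_le[OF t]] unfolding S_def by simp
      have "(\<lambda>m. X m \<omega>) \<longlonglongrightarrow> Y 0 \<omega> \<bullet> ?v + ((Y s \<omega> - exp (- (rate * s)) *\<^sub>R Y 0 \<omega>) \<bullet> z +
          (Y (s + t) \<omega> - exp (- (rate * t)) *\<^sub>R Y s \<omega>) \<bullet> w)"
        unfolding X_def by (intro tendsto_add tendsto_inner tendsto_const 1 2)
      then show ?case by (simp add: inner_diff_left)
    qed
  qed
  moreover have "(\<lambda>m. LINT \<omega>|M. iexp (X m \<omega>)) \<longlonglongrightarrow> char_fun (distr M borel (Y 0)) ?v *
     (exp (LINT r:{0<..s}|lborel. c (exp (- (rate * (s - r))) *\<^sub>R z)) *
     exp (LINT r:{0<..t}|lborel. c (exp (- (rate * (t - r))) *\<^sub>R w)))"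
  proof -
    have riem: "(\<lambda>m. \<Sum>k<Suc m. (T / Suc m) *\<^sub>R c (exp (- (rate * (T - T * k / Suc m))) *\<^sub>R x))
        \<longlonglongrightarrow> (LINT r:{0<..T}|lborel. c (exp (- (rate * (T - r))) *\<^sub>R x))" if "T \<ge> 0" for T :: real and x
    proof (cases "T = 0")
      case True
      then show ?thesis by (simp add: set_lebesgue_integral_def)
    next
      case False
      then show ?thesis using that
        by (intro riemann_sum_tendsto[where g="\<lambda>r. c (exp (- (rate * (T - r))) *\<^sub>R x)"] continuous_on_compose2[OF c(1)] continuous_intros) auto
    qed
    show ?thesis
      unfolding X_char S_char by (intro tendsto_mult tendsto_const tendsto_exp riem) (use s t in auto)
  qed
  ultimately show ?thesis by (simp add: LIMSEQ_unique mult.assoc)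
qed

end

section \<open>The DGGa distribution\<close>

lemma scale_measure_eq_density: "scale_measure c M = density M (\<lambda>_. c)"
  by (rule measure_eqI) (simp_all add: emeasure_density_const)

lemma integral_scale_measure:
  fixes f :: "'a \<Rightarrow> 'b::{banach, second_countable_topology}"
  assumes "0 \<le> c" "f \<in> borel_measurable M"
  shows "(LINT x|scale_measure (ennreal c) M. f x) = c *\<^sub>R (LINT x|M. f x)"
  using assms by (simp add: scale_measure_eq_density integral_density)

definition tempering_density :: "real \<Rightarrow> real \<Rightarrow> real \<Rightarrow> real" where
  "tempering_density p \<alpha> u = u powr (- 1 - \<alpha>) * exp (- (u powr p))"

text \<open>By \<open>gengamma_density_eq\<close> this is the generalized gamma law without its
  normalising factor \<open>p / Gamma (- \<alpha> / p)\<close>.\<close>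

definition tempering_measure :: "real \<Rightarrow> real \<Rightarrow> real measure" where
  "tempering_measure p \<alpha> = density lborel (\<lambda>u. ennreal (indicator {0<..} u * tempering_density p \<alpha> u))"

text \<open>Left unnormalised, with mass ln \<eta>: for \<open>\<eta> = exp (rate * t)\<close> it is
  the image of rate dr on [0, t] under the map sending r to exp (rate * (t - r)).\<close>

definition log_uniform :: "real \<Rightarrow> real measure" where
  "log_uniform \<eta> = density lborel (\<lambda>q. ennreal (indicator {1..\<eta>} q * (1 / q)))"

lemma tempering_density_measurable [measurable]: "tempering_density p \<alpha> \<in> borel_measurable borel"
  unfolding tempering_density_def[abs_def] by measurable

lemma tempering_density_nonneg [simp]: "0 \<le> tempering_density p \<alpha> u"
  by (simp add: tempering_density_def)

lemma sets_tempering_measure [simp, measurable_cong]: "sets (tempering_measure p \<alpha>) = sets borel"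
  by (simp add: tempering_measure_def)

lemma sets_log_uniform [simp, measurable_cong]: "sets (log_uniform \<eta>) = sets borel"
  by (simp add: log_uniform_def)

lemma emeasure_log_uniform:
  assumes "\<eta> \<ge> 1"
  shows "emeasure (log_uniform \<eta>) UNIV = ennreal (ln \<eta>)"
proof -
  have "emeasure (log_uniform \<eta>) UNIV = (\<integral>\<^sup>+q. ennreal (1 / q) * indicator {1..\<eta>} q \<partial>lborel)"
    unfolding log_uniform_def
    by (subst emeasure_density) (auto intro!: nn_integral_cong simp: indicator_def)
  also have "\<dots> = ennreal (ln \<eta> - ln 1)"
    using assms by (intro nn_integral_FTC_Icc) (auto intro!: derivative_eq_intros)
  finally show ?thesis by simp
qed

lemma sigma_finite_density_real:
  fixes f :: "real \<Rightarrow> real"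
  assumes "f \<in> borel_measurable borel"
  shows "sigma_finite_measure (density lborel (\<lambda>x. ennreal (f x)))"
  using assms by (subst sigma_finite_measure.sigma_finite_iff_density_finite[OF sigma_finite_lborel]) auto

lemma sigma_finite_tempering: "sigma_finite_measure (tempering_measure p \<alpha>)"
  unfolding tempering_measure_def by (intro sigma_finite_density_real) measurable

lemma gengamma_density_eq:
  "gengamma_density (- \<alpha>) p u = p / Gamma (- \<alpha> / p) * tempering_density p \<alpha> u"
proof -
  have "- \<alpha> - 1 = - 1 - \<alpha>" by simp
  then show ?thesis unfolding gengamma_density_def tempering_density_def by (simp only:)
qed

lemma Gamma_quotient_pos: "p > 0 \<Longrightarrow> \<alpha> < 0 \<Longrightarrow> 0 < Gamma (- \<alpha> / p :: real)"
  by (intro Gamma_real_pos divide_pos_pos) auto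

text \<open>The substitution u = x q absorbs the factor 1 / x and makes the domain of integration
  independent of \<open>x\<close>. The integral is a nonnegative one so that Tonelli applies to it
  next.\<close>

lemma DGGa_density_eq:
  assumes "x > 0" "\<eta> > 1" "p > 0" "\<alpha> < 0"
  defines "\<kappa> \<equiv> p / Gamma (- \<alpha> / p)"
  shows "ennreal (DGGa_density (- \<alpha>) p \<eta> x) =
     (\<integral>\<^sup>+q. ennreal (\<kappa> / ln \<eta>) * ennreal (indicator {1..\<eta>} q * tempering_density p \<alpha> (x * q)) \<partial>lborel)"
proof -
  have \<kappa>: "\<kappa> > 0" unfolding \<kappa>_def using assms by (intro divide_pos_pos Gamma_quotient_pos)
  let ?g = "tempering_density p \<alpha>"
  have int: "set_integrable lborel {x..x * \<eta>} ?g"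
    unfolding set_integrable_def tempering_density_def
    by (intro borel_integrable_compact compact_Icc continuous_intros) (use assms in auto)
  have "(LINT u:{x..x * \<eta>}|lborel. gengamma_density (- \<alpha>) p u) = \<kappa> * (LINT u:{x..x * \<eta>}|lborel. ?g u)"
    by (simp add: gengamma_density_eq \<kappa>_def)
  then have "DGGa_density (- \<alpha>) p \<eta> x = (\<kappa> / ln \<eta>) * ((1 / x) * (LINT u:{x..x * \<eta>}|lborel. ?g u))"
    using assms(1) by (simp add: DGGa_density_def)
  also have "ennreal \<dots> = ennreal (\<kappa> / ln \<eta>) * (ennreal (1 / x) * ennreal (LINT u:{x..x * \<eta>}|lborel. ?g u))"
  proof -
    have "0 \<le> (LINT u:{x..x * \<eta>}|lborel. ?g u)"
      unfolding set_lebesgue_integral_def by (intro integral_nonneg_AE) auto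
    then show ?thesis using assms(1,2) \<kappa> by (simp add: ennreal_mult del: times_divide_eq_left times_divide_eq_right)
  qed
  also have "ennreal (LINT u:{x..x * \<eta>}|lborel. ?g u) = (\<integral>\<^sup>+u. ennreal (indicator {x..x * \<eta>} u * ?g u) \<partial>lborel)"
    using int unfolding set_lebesgue_integral_def set_integrable_def
    by (subst nn_integral_eq_integral) auto
  also have "\<dots> = ennreal x * (\<integral>\<^sup>+q. ennreal (indicator {x..x * \<eta>} (0 + x * q) * ?g (0 + x * q)) \<partial>lborel)"
    using assms(1) by (subst nn_integral_real_affine[where c=x and t=0]) auto
  also have "(\<integral>\<^sup>+q. ennreal (indicator {x..x * \<eta>} (0 + x * q) * ?g (0 + x * q)) \<partial>lborel) =
      (\<integral>\<^sup>+q. ennreal (indicator {1..\<eta>} q * ?g (x * q)) \<partial>lborel)"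
    using assms(1) by (intro nn_integral_cong) (auto simp: indicator_def)
  also have "ennreal (1 / x) * (ennreal x * (\<integral>\<^sup>+q. ennreal (indicator {1..\<eta>} q * ?g (x * q)) \<partial>lborel)) =
      (\<integral>\<^sup>+q. ennreal (indicator {1..\<eta>} q * ?g (x * q)) \<partial>lborel)"
    using assms(1) by (simp add: mult.assoc[symmetric] ennreal_mult[symmetric])
  also have "ennreal (\<kappa> / ln \<eta>) * \<dots> =
     (\<integral>\<^sup>+q. ennreal (\<kappa> / ln \<eta>) * ennreal (indicator {1..\<eta>} q * ?g (x * q)) \<partial>lborel)"
    by (subst nn_integral_cmult) auto
  finally show ?thesis .
qed

lemma DGGa_density_measurable:
  assumes "\<eta> > 1" "p > 0" "\<alpha> < 0"
  shows "(\<lambda>x. ennreal (DGGa_density (- \<alpha>) p \<eta> x)) \<in> borel_measurable borel"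
proof -
  have "(\<lambda>x. ennreal (DGGa_density (- \<alpha>) p \<eta> x)) = (\<lambda>x. indicator {0<..} x *
     (\<integral>\<^sup>+q. ennreal (p / Gamma (- \<alpha> / p) / ln \<eta>) * ennreal (indicator {1..\<eta>} q * tempering_density p \<alpha> (x * q)) \<partial>lborel))"
    using DGGa_density_eq[OF _ assms] by (auto simp: fun_eq_iff indicator_def DGGa_density_def)
  also have "\<dots> \<in> borel_measurable borel" by measurable
  finally show ?thesis .
qed

text \<open>After exchanging the integrals, u = x q is substituted for fixed \<open>q\<close>. The
  Jacobian 1 / q is the density of \<open>log_uniform\<close>, and \<open>x\<close> becomes the
  quotient u / q.\<close>

lemma DGGa_eq_quotient:
  assumes "\<eta> > 1" "p > 0" "\<alpha> < 0"
  shows "DGGa (- \<alpha>) p \<eta> = scale_measure (ennreal (p / Gamma (- \<alpha> / p) / ln \<eta>))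
     (distr (log_uniform \<eta> \<Otimes>\<^sub>M tempering_measure p \<alpha>) borel (\<lambda>(q, u). u / q))"
proof (rule measure_eqI)
  fix A assume "A \<in> sets (DGGa (- \<alpha>) p \<eta>)"
  then have [measurable]: "A \<in> sets borel" by (simp add: DGGa_def)
  define K where "K = p / Gamma (- \<alpha> / p) / ln \<eta>"
  let ?g = "tempering_density p \<alpha>"
  interpret T: sigma_finite_measure "tempering_measure p \<alpha>" by (rule sigma_finite_tempering)
  have "emeasure (DGGa (- \<alpha>) p \<eta>) A =
      (\<integral>\<^sup>+x. ennreal (DGGa_density (- \<alpha>) p \<eta> x) * indicator A x \<partial>lborel)"
    unfolding DGGa_def using DGGa_density_measurable[OF assms] by (subst emeasure_density) auto
  also have "\<dots> = (\<integral>\<^sup>+x. (\<integral>\<^sup>+q. ennreal K * (indicator A x * indicator {0<..} x * ennreal (indicator {1..\<eta>} q * ?g (x * q))) \<partial>lborel) \<partial>lborel)"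
  proof (intro nn_integral_cong)
    fix x
    show "ennreal (DGGa_density (- \<alpha>) p \<eta> x) * indicator A x =
      (\<integral>\<^sup>+q. ennreal K * (indicator A x * indicator {0<..} x * ennreal (indicator {1..\<eta>} q * ?g (x * q))) \<partial>lborel)"
      using DGGa_density_eq[OF _ assms, of x]
      by (cases "x > 0"; cases "x \<in> A") (auto simp: K_def DGGa_density_def)
  qed
  also have "\<dots> = (\<integral>\<^sup>+q. (\<integral>\<^sup>+x. ennreal K * (indicator A x * indicator {0<..} x * ennreal (indicator {1..\<eta>} q * ?g (x * q))) \<partial>lborel) \<partial>lborel)"
    by (rule lborel_pair.Fubini') measurable
  also have "\<dots> = (\<integral>\<^sup>+q. ennreal K * (ennreal (indicator {1..\<eta>} q * (1 / q)) *
      (\<integral>\<^sup>+u. indicator A (u / q) \<partial>tempering_measure p \<alpha>)) \<partial>lborel)"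
  proof (intro nn_integral_cong)
    fix q :: real
    show "(\<integral>\<^sup>+x. ennreal K * (indicator A x * indicator {0<..} x * ennreal (indicator {1..\<eta>} q * ?g (x * q))) \<partial>lborel) =
      ennreal K * (ennreal (indicator {1..\<eta>} q * (1 / q)) * (\<integral>\<^sup>+u. indicator A (u / q) \<partial>tempering_measure p \<alpha>))"
    proof (cases "q \<in> {1..\<eta>}")
      case True
      then have q: "q > 0" by auto
      have "(\<integral>\<^sup>+x. ennreal K * (indicator A x * indicator {0<..} x * ennreal (indicator {1..\<eta>} q * ?g (x * q))) \<partial>lborel) =
          ennreal K * (\<integral>\<^sup>+x. indicator A x * indicator {0<..} x * ennreal (?g (x * q)) \<partial>lborel)"
        using True by (simp add: nn_integral_cmult)
      also have "(\<integral>\<^sup>+x. indicator A x * indicator {0<..} x * ennreal (?g (x * q)) \<partial>lborel) =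
          ennreal (1 / q) * (\<integral>\<^sup>+u. indicator A (0 + 1 / q * u) * indicator {0<..} (0 + 1 / q * u) * ennreal (?g ((0 + 1 / q * u) * q)) \<partial>lborel)"
        using q by (subst nn_integral_real_affine[where c="1 / q" and t=0]) auto
      also have "(\<integral>\<^sup>+u. indicator A (0 + 1 / q * u) * indicator {0<..} (0 + 1 / q * u) * ennreal (?g ((0 + 1 / q * u) * q)) \<partial>lborel) =
          (\<integral>\<^sup>+u. ennreal (indicator {0<..} u * ?g u) * indicator A (u / q) \<partial>lborel)"
        using q by (intro nn_integral_cong) (auto simp: indicator_def zero_less_divide_iff)
      also have "\<dots> = (\<integral>\<^sup>+u. indicator A (u / q) \<partial>tempering_measure p \<alpha>)"
        unfolding tempering_measure_def by (subst nn_integral_density) auto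
      finally show ?thesis using True by simp
    qed simp
  qed
  also have "\<dots> = ennreal K * (\<integral>\<^sup>+q. ennreal (indicator {1..\<eta>} q * (1 / q)) *
      (\<integral>\<^sup>+u. indicator A (u / q) \<partial>tempering_measure p \<alpha>) \<partial>lborel)"
    by (rule nn_integral_cmult) measurable
  also have "(\<integral>\<^sup>+q. ennreal (indicator {1..\<eta>} q * (1 / q)) * (\<integral>\<^sup>+u. indicator A (u / q) \<partial>tempering_measure p \<alpha>) \<partial>lborel) =
      (\<integral>\<^sup>+q. (\<integral>\<^sup>+u. indicator A (u / q) \<partial>tempering_measure p \<alpha>) \<partial>log_uniform \<eta>)"
    unfolding log_uniform_def by (subst nn_integral_density) auto
  also have "\<dots> = (\<integral>\<^sup>+x. indicator A (case x of (q, u) \<Rightarrow> u / q) \<partial>(log_uniform \<eta> \<Otimes>\<^sub>M tempering_measure p \<alpha>))"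
    by (subst T.nn_integral_fst[symmetric]) auto
  also have "\<dots> = (\<integral>\<^sup>+x. indicator A x \<partial>distr (log_uniform \<eta> \<Otimes>\<^sub>M tempering_measure p \<alpha>) borel (\<lambda>(q, u). u / q))"
    by (subst nn_integral_distr) auto
  also have "\<dots> = emeasure (distr (log_uniform \<eta> \<Otimes>\<^sub>M tempering_measure p \<alpha>) borel (\<lambda>(q, u). u / q)) A"
    by simp
  finally show "emeasure (DGGa (- \<alpha>) p \<eta>) A = emeasure (scale_measure (ennreal (p / Gamma (- \<alpha> / p) / ln \<eta>))
     (distr (log_uniform \<eta> \<Otimes>\<^sub>M tempering_measure p \<alpha>) borel (\<lambda>(q, u). u / q))) A"
    by (simp add: K_def)
qed (simp add: DGGa_def)

text \<open>Compare total masses in \<open>DGGa_eq_quotient\<close>: the left side has mass 1, the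
  right side \<open>p / Gamma (- \<alpha> / p) / ln \<eta>\<close> times ln \<eta> times the unknown
  mass.\<close>

lemma finite_tempering_measure:
  assumes "\<eta> > 1" "p > 0" "\<alpha> < 0" "prob_space (DGGa (- \<alpha>) p \<eta>)"
  shows "finite_measure (tempering_measure p \<alpha>)"
    and "measure (tempering_measure p \<alpha>) UNIV = Gamma (- \<alpha> / p) / p"
proof -
  interpret T: sigma_finite_measure "tempering_measure p \<alpha>" by (rule sigma_finite_tempering)
  define K where "K = p / Gamma (- \<alpha> / p)"
  have K: "K > 0" unfolding K_def using assms by (intro divide_pos_pos Gamma_quotient_pos)
  let ?G = "emeasure (tempering_measure p \<alpha>) UNIV"
  let ?P = "log_uniform \<eta> \<Otimes>\<^sub>M tempering_measure p \<alpha>"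
  have sp: "space (tempering_measure p \<alpha>) = UNIV" "space (log_uniform \<eta>) = UNIV"
    by (auto simp: tempering_measure_def log_uniform_def)
  have "1 = emeasure (DGGa (- \<alpha>) p \<eta>) UNIV"
    using prob_space.emeasure_space_1[OF assms(4)] by (simp add: DGGa_def)
  also have "\<dots> = ennreal (K / ln \<eta>) * emeasure ?P (UNIV \<times> UNIV)"
    unfolding DGGa_eq_quotient[OF assms(1-3)] K_def
    by (simp add: emeasure_distr space_pair_measure sp)
  also have "emeasure ?P (UNIV \<times> UNIV) = emeasure (log_uniform \<eta>) UNIV * ?G"
    by (rule T.emeasure_pair_measure_Times) auto
  also have "emeasure (log_uniform \<eta>) UNIV = ennreal (ln \<eta>)"
    using assms by (intro emeasure_log_uniform) auto
  also have "ennreal (K / ln \<eta>) * (ennreal (ln \<eta>) * ?G) = ennreal K * ?G"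
    using assms K by (simp add: mult.assoc[symmetric] ennreal_mult[symmetric])
  finally have KG: "ennreal K * ?G = 1" by simp
  have "ennreal (1 / K) = ennreal (1 / K) * (ennreal K * ?G)" by (simp add: KG)
  also have "\<dots> = ?G" using K by (simp add: mult.assoc[symmetric] ennreal_mult[symmetric])
  finally have G: "?G = ennreal (1 / K)" by simp
  then show "finite_measure (tempering_measure p \<alpha>)" by (intro finite_measureI) (simp add: sp)
  show "measure (tempering_measure p \<alpha>) UNIV = Gamma (- \<alpha> / p) / p"
    using G K Gamma_quotient_pos[OF assms(2,3)] assms(2) by (simp add: measure_def K_def)
qed

lemma finite_log_uniform: "\<eta> \<ge> 1 \<Longrightarrow> finite_measure (log_uniform \<eta>)"
  using emeasure_log_uniform[of \<eta>] by (intro finite_measureI) (simp add: log_uniform_def)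

lemma integral_DGGa:
  fixes f :: "real \<Rightarrow> complex"
  assumes "\<eta> > 1" "p > 0" "\<alpha> < 0" "prob_space (DGGa (- \<alpha>) p \<eta>)"
    and [measurable]: "f \<in> borel_measurable borel" and B: "\<And>x. norm (f x) \<le> B"
  shows "(LINT v|DGGa (- \<alpha>) p \<eta>. f v) = (p / Gamma (- \<alpha> / p) / ln \<eta>) *\<^sub>R
     (LINT q|log_uniform \<eta>. (LINT u|tempering_measure p \<alpha>. f (u / q)))"
proof -
  interpret T: finite_measure "tempering_measure p \<alpha>" by (rule finite_tempering_measure[OF assms(1-4)])
  interpret Q: finite_measure "log_uniform \<eta>" using assms by (intro finite_log_uniform) auto
  interpret TQ: pair_sigma_finite "log_uniform \<eta>" "tempering_measure p \<alpha>" ..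
  interpret F: finite_measure "log_uniform \<eta> \<Otimes>\<^sub>M tempering_measure p \<alpha>"
    by (rule finite_measure_pair_measure) unfold_locales
  have K: "0 \<le> p / Gamma (- \<alpha> / p) / ln \<eta>"
    using assms by (intro divide_nonneg_nonneg less_imp_le[OF Gamma_quotient_pos]) auto
  have "(LINT v|DGGa (- \<alpha>) p \<eta>. f v) = (p / Gamma (- \<alpha> / p) / ln \<eta>) *\<^sub>R
      (LINT x|(log_uniform \<eta> \<Otimes>\<^sub>M tempering_measure p \<alpha>). f (case x of (q, u) \<Rightarrow> u / q))"
    unfolding DGGa_eq_quotient[OF assms(1-3)] using K
    by (subst integral_scale_measure) (auto simp: integral_distr)
  also have "(LINT x|(log_uniform \<eta> \<Otimes>\<^sub>M tempering_measure p \<alpha>). f (case x of (q, u) \<Rightarrow> u / q)) =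
      (LINT q|log_uniform \<eta>. (LINT u|tempering_measure p \<alpha>. f (u / q)))"
    by (subst TQ.integral_fst'[symmetric])
       (auto intro!: F.integrable_const_bound[where B=B] B simp: split_beta)
  finally show ?thesis .
qed

section \<open>Compound Poisson sums\<close>

locale compound_poisson = prob_space M for M :: "'v measure" +
  fixes N :: "'v \<Rightarrow> nat" and V :: "nat \<Rightarrow> 'v \<Rightarrow> 'a::euclidean_space" and W :: "nat \<Rightarrow> 'v \<Rightarrow> real"
    and m :: real
  assumes N [measurable]: "N \<in> M \<rightarrow>\<^sub>M count_space UNIV"
    and V [measurable]: "\<And>n. n \<ge> 1 \<Longrightarrow> V n \<in> borel_measurable M"
    and W [measurable]: "\<And>n. n \<ge> 1 \<Longrightarrow> W n \<in> borel_measurable M"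
    and indep: "indep_NVW M N V W"
    and N_distr: "distr M (count_space UNIV) N = measure_pmf (poisson_pmf m)"
    and m: "m > 0"
begin

lemma distr_V_W:
  assumes "n \<ge> 1"
  shows "distr M borel (V n) \<Otimes>\<^sub>M distr M borel (W n) = distr M (borel \<Otimes>\<^sub>M borel) (\<lambda>\<omega>. (V n \<omega>, W n \<omega>))"
proof (rule pair_measure_eqI)
  have [measurable]: "V n \<in> borel_measurable M" "W n \<in> borel_measurable M" using assms by auto
  show "sigma_finite_measure (distr M borel (V n))" "sigma_finite_measure (distr M borel (W n))"
    by (auto intro!: prob_space_imp_sigma_finite prob_space_distr)
  fix A B assume "A \<in> sets (distr M borel (V n))" "B \<in> sets (distr M borel (W n))"
  then have [measurable]: "A \<in> sets borel" "B \<in> sets borel" by auto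
  let ?I = "insert Count (Jump ` {1..} \<union> Factor ` {1..})"
  let ?a = "V n -` A \<inter> space M" and ?b = "W n -` B \<inter> space M"
  have "prob (\<Inter>i\<in>{Jump n, Factor n}. (case i of Jump _ \<Rightarrow> ?a | _ \<Rightarrow> ?b)) =
      (\<Prod>i\<in>{Jump n, Factor n}. prob (case i of Jump _ \<Rightarrow> ?a | _ \<Rightarrow> ?b))"
    by (rule indep_setsD[OF indep[unfolded indep_NVW_def]])
       (use assms in \<open>auto intro!: in_vimage_algebra\<close>)
  then have "prob (?a \<inter> ?b) = prob ?a * prob ?b" by simp
  moreover have "(\<lambda>\<omega>. (V n \<omega>, W n \<omega>)) -` (A \<times> B) \<inter> space M = ?a \<inter> ?b" by auto
  ultimately show "emeasure (distr M borel (V n)) A * emeasure (distr M borel (W n)) B =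
      emeasure (distr M (borel \<Otimes>\<^sub>M borel) (\<lambda>\<omega>. (V n \<omega>, W n \<omega>))) (A \<times> B)"
    by (simp add: emeasure_distr emeasure_eq_measure ennreal_mult)
qed simp

lemma integral_V_W:
  fixes f :: "'a \<Rightarrow> real \<Rightarrow> complex"
  assumes "n \<ge> 1" and [measurable]: "case_prod f \<in> borel_measurable (borel \<Otimes>\<^sub>M borel)"
    and B: "\<And>x v. norm (f x v) \<le> B"
  shows "(LINT \<omega>|M. f (V n \<omega>) (W n \<omega>)) = (LINT x|distr M borel (V n). (LINT v|distr M borel (W n). f x v))"
proof -
  have [measurable]: "V n \<in> borel_measurable M" "W n \<in> borel_measurable M" using assms by auto
  interpret A: prob_space "distr M borel (V n)" by (rule prob_space_distr) simp
  interpret B: prob_space "distr M borel (W n)" by (rule prob_space_distr) simp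
  interpret AB: pair_prob_space "distr M borel (V n)" "distr M borel (W n)" ..
  have "(LINT \<omega>|M. f (V n \<omega>) (W n \<omega>)) = (LINT y|distr M (borel \<Otimes>\<^sub>M borel) (\<lambda>\<omega>. (V n \<omega>, W n \<omega>)). case_prod f y)"
    by (subst integral_distr) auto
  also have "\<dots> = (LINT y|(distr M borel (V n) \<Otimes>\<^sub>M distr M borel (W n)). case_prod f y)" by (simp only: distr_V_W[OF assms(1)])
  also have "\<dots> = (LINT x|distr M borel (V n). (LINT v|distr M borel (W n). f x v))"
    by (subst AB.integral_fst'[symmetric])
       (auto intro!: AB.P.integrable_const_bound[where B=B] simp: B split_beta)
  finally show ?thesis .
qed

text \<open>On the event \<open>N = k\<close> the random sum has the fixed length \<open>k\<close>.
  The indicator of this event and the \<open>k\<close> pairs of jump and factor are independent, so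
  the expectation is the Poisson weight times a power.\<close>

lemma integral_count_prod:
  assumes \<psi>: "\<And>n. n \<ge> 1 \<Longrightarrow> (LINT \<omega>|M. iexp (W n \<omega> * (V n \<omega> \<bullet> z))) = \<psi>"
  shows "(LINT \<omega>|M. indicator {k} (N \<omega>) * (\<Prod>n=1..k. iexp (W n \<omega> * (V n \<omega> \<bullet> z)))) =
     of_real (m ^ k / fact k * exp (- m)) * \<psi> ^ k"
proof -
  let ?I = "insert Count (Jump ` {1..} \<union> Factor ` {1..})"
  let ?S = "\<lambda>i. case i of Count \<Rightarrow> sets (vimage_algebra (space M) N (count_space UNIV))
         | Jump n \<Rightarrow> sets (vimage_algebra (space M) (V n) borel)
         | Factor n \<Rightarrow> sets (vimage_algebra (space M) (W n) borel)"
  \<comment> \<open>\<open>indep_vars\<close> with the constant target \<open>borel\<close> needs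
    one value type for counts, vectors and reals; each is embedded in the product
    \<open>'a \<times> real\<close>, with 0 in the other component.\<close>
  define X :: "var_index \<Rightarrow> 'v \<Rightarrow> 'a \<times> real" where
    "X i \<omega> = (case i of Count \<Rightarrow> (0, real (N \<omega>)) | Jump n \<Rightarrow> (V n \<omega>, 0) | Factor n \<Rightarrow> (0, W n \<omega>))" for i \<omega>
  have ind: "indep_sets ?S ?I" using indep by (simp add: indep_NVW_def)
  have X_simps: "X Count = (\<lambda>\<omega>. (0, real (N \<omega>)))" "X (Jump n) = (\<lambda>\<omega>. (V n \<omega>, 0))"
    "X (Factor n) = (\<lambda>\<omega>. (0, W n \<omega>))" for n
    by (simp_all add: X_def fun_eq_iff)
  have emb: "(\<lambda>n. (0, real n)) \<in> count_space UNIV \<rightarrow>\<^sub>M (borel :: ('a \<times> real) measure)"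
    "(\<lambda>v. (v, 0)) \<in> borel \<rightarrow>\<^sub>M (borel :: ('a \<times> real) measure)"
    "(\<lambda>w. (0, w)) \<in> borel \<rightarrow>\<^sub>M (borel :: ('a \<times> real) measure)"
    by (simp, (intro borel_measurable_continuous_onI continuous_intros)+)
  have X: "indep_vars (\<lambda>_. borel) X ?I"
    unfolding indep_vars_def2
  proof (intro conjI ballI)
    fix i assume i: "i \<in> ?I"
    show "X i \<in> borel_measurable M"
    proof (cases i)
      case Count
      show ?thesis unfolding Count X_simps by (rule measurable_compose[OF N emb(1)])
    next
      case (Jump n)
      then have "n \<ge> 1" using i by auto
      then show ?thesis unfolding Jump X_simps by (intro measurable_compose[OF V emb(2)])
    next
      case (Factor n)
      then have "n \<ge> 1" using i by auto
      then show ?thesis unfolding Factor X_simps by (intro measurable_compose[OF W emb(3)])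
    qed
  next
    show "indep_sets (\<lambda>i. {X i -` A \<inter> space M |A. A \<in> sets borel}) ?I"
    proof (rule indep_sets_mono_sets[OF ind])
      fix i
      have vi: "{(\<lambda>\<omega>. h (g \<omega>)) -` A \<inter> space M |A. A \<in> sets borel} \<subseteq> sets (vimage_algebra (space M) g T)"
        if "h \<in> T \<rightarrow>\<^sub>M borel" "space T = UNIV"
        for g :: "'v \<Rightarrow> 'c" and T and h :: "'c \<Rightarrow> 'a \<times> real"
      proof safe
        fix A :: "('a \<times> real) set" assume "A \<in> sets borel"
        then have "h -` A \<in> sets T" using measurable_sets[OF that(1)] that(2) by simp
        then have "g -` (h -` A) \<inter> space M \<in> sets (vimage_algebra (space M) g T)"
          by (rule in_vimage_algebra)
        then show "(\<lambda>\<omega>. h (g \<omega>)) -` A \<inter> space M \<in> sets (vimage_algebra (space M) g T)"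
          by (simp add: vimage_def)
      qed
      show "{X i -` A \<inter> space M |A. A \<in> sets borel} \<subseteq> ?S i"
        by (cases i) (simp_all only: X_simps var_index.case vi[OF emb(1)] vi[OF emb(2)] vi[OF emb(3)] space_borel space_count_space)
    qed
  qed
  \<comment> \<open>Disjoint blocks of indices: the count alone, and each jump with its factor.
    Functions of disjoint blocks of an independent family are again independent.\<close>
  define K where "K j = (if j = 0 then {Count} else {Jump j, Factor j})" for j :: nat
  define Y :: "nat \<Rightarrow> (var_index \<Rightarrow> 'a \<times> real) \<Rightarrow> complex" where
    "Y j x = (if j = 0 then indicator {real k} (snd (x Count)) else iexp (snd (x (Factor j)) * (fst (x (Jump j)) \<bullet> z)))" for j x
  have "indep_vars (\<lambda>j. PiM (K j) (\<lambda>_. borel)) (\<lambda>j \<omega>. restrict (\<lambda>i. X i \<omega>) (K j)) {..k}"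
    by (rule indep_vars_restrict[OF X]) (auto simp: K_def disjoint_family_on_def)
  then have "indep_vars (\<lambda>_. borel) (\<lambda>j \<omega>. Y j (restrict (\<lambda>i. X i \<omega>) (K j))) {..k}"
  proof (rule indep_vars_compose2)
    fix j
    have comp: "(\<lambda>x. x i) \<in> PiM (K j) (\<lambda>_. borel) \<rightarrow>\<^sub>M (borel \<Otimes>\<^sub>M borel :: ('a \<times> real) measure)" if "i \<in> K j" for i
      using measurable_component_singleton[OF that, of "\<lambda>_. borel :: ('a \<times> real) measure"] by (simp add: borel_prod)
    show "Y j \<in> PiM (K j) (\<lambda>_. borel) \<rightarrow>\<^sub>M borel"
    proof (cases "j = 0")
      case True
      then have [measurable]: "(\<lambda>x. x Count) \<in> PiM (K j) (\<lambda>_. borel) \<rightarrow>\<^sub>M (borel \<Otimes>\<^sub>M borel :: ('a \<times> real) measure)"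
        by (intro comp) (simp add: K_def)
      have "Y j = (\<lambda>x. indicator {real k} (snd (x Count)))" by (simp add: Y_def True fun_eq_iff)
      then show ?thesis by (simp only:) measurable
    next
      case False
      then have [measurable]: "(\<lambda>x. x (Jump j)) \<in> PiM (K j) (\<lambda>_. borel) \<rightarrow>\<^sub>M (borel \<Otimes>\<^sub>M borel :: ('a \<times> real) measure)"
          "(\<lambda>x. x (Factor j)) \<in> PiM (K j) (\<lambda>_. borel) \<rightarrow>\<^sub>M (borel \<Otimes>\<^sub>M borel :: ('a \<times> real) measure)"
        by (intro comp; simp add: K_def)+
      have "Y j = (\<lambda>x. iexp (snd (x (Factor j)) * (fst (x (Jump j)) \<bullet> z)))"
        by (simp add: Y_def False fun_eq_iff)
      then show ?thesis by (simp only:) measurable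
    qed
  qed
  moreover have Y: "Y j (restrict (\<lambda>i. X i \<omega>) (K j)) =
      (if j = 0 then indicator {k} (N \<omega>) else iexp (W j \<omega> * (V j \<omega> \<bullet> z)))" for j \<omega>
    by (auto simp: Y_def K_def X_def indicator_def)
  ultimately have indY: "indep_vars (\<lambda>_. borel) (\<lambda>j \<omega>. if j = 0 then indicator {k} (N \<omega>) else iexp (W j \<omega> * (V j \<omega> \<bullet> z))) {..k}"
    by simp
  have split: "(\<Prod>j\<le>k. f j) = f 0 * (\<Prod>j=1..k. f j)" for f :: "nat \<Rightarrow> complex"
    by (simp add: atMost_atLeast0 prod.atLeast_Suc_atMost)
  have "(LINT \<omega>|M. indicator {k} (N \<omega>) * (\<Prod>n=1..k. iexp (W n \<omega> * (V n \<omega> \<bullet> z)))) =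
      (LINT \<omega>|M. (\<Prod>j\<le>k. if j = 0 then indicator {k} (N \<omega>) else iexp (W j \<omega> * (V j \<omega> \<bullet> z))))"
    unfolding split by (intro Bochner_Integration.integral_cong refl arg_cong2[where f="(*)"] prod.cong) auto
  also have "\<dots> = (\<Prod>j\<le>k. (LINT \<omega>|M. (if j = 0 then indicator {k} (N \<omega>) else iexp (W j \<omega> * (V j \<omega> \<bullet> z)))))"
  proof (intro indep_vars_lebesgue_integral indY)
    fix j
    show "integrable M (\<lambda>\<omega>. if j = 0 then indicator {k} (N \<omega>) else iexp (W j \<omega> * (V j \<omega> \<bullet> z)) :: complex)"
      by (cases "j = 0") (auto intro!: integrable_const_bound[where B=1] simp: indicator_def)
  qed simp
  also have "\<dots> = (LINT \<omega>|M. indicator {k} (N \<omega>)) * (\<Prod>j=1..k. \<psi>)"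
    unfolding split
  proof (intro arg_cong2[where f="(*)"] prod.cong refl)
    fix j assume "j \<in> {1..k}"
    then show "(LINT \<omega>|M. (if j = 0 then indicator {k} (N \<omega>) else iexp (W j \<omega> * (V j \<omega> \<bullet> z)))) = \<psi>"
      using \<psi>[of j] by simp
  qed simp
  also have "(LINT \<omega>|M. indicator {k} (N \<omega>) :: complex) = of_real (m ^ k / fact k * exp (- m))"
  proof -
    have "(LINT \<omega>|M. indicator {k} (N \<omega>) :: complex) = (LINT i|distr M (count_space UNIV) N. indicator {k} i)"
      by (subst integral_distr) auto
    also have "\<dots> = of_real (measure (measure_pmf (poisson_pmf m)) {k})"
    proof -
      have "(LINT i|measure_pmf (poisson_pmf m). indicator {k} i :: complex) =
          (LINT i|measure_pmf (poisson_pmf m). of_real (indicator {k} i))"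
        by (intro Bochner_Integration.integral_cong refl) (simp add: indicator_def)
      then show ?thesis unfolding N_distr integral_complex_of_real by simp
    qed
    finally show ?thesis using m by (simp add: measure_pmf_single)
  qed
  finally show ?thesis by simp
qed

lemma measurable_random_sum [measurable]: "(\<lambda>\<omega>. \<Sum>n=1..N \<omega>. W n \<omega> *\<^sub>R V n \<omega>) \<in> borel_measurable M"
proof -
  have "(\<lambda>\<omega>. (\<lambda>k \<omega>. \<Sum>n=1..k. W n \<omega> *\<^sub>R V n \<omega>) (N \<omega>) \<omega>) \<in> borel_measurable M"
    by (rule measurable_compose_countable[OF _ N]) (auto intro!: borel_measurable_sum)
  then show ?thesis by simp
qed

text \<open>Decompose according to the value of \<open>N\<close>. Summing the Poisson weights times
  \<open>\<psi> ^ k\<close> yields the exponential series; the laws of \<open>V n\<close> and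
  \<open>W n\<close> enter through \<open>\<psi>\<close> only.\<close>

lemma char_random_sum:
  assumes \<psi>: "\<And>n. n \<ge> 1 \<Longrightarrow> (LINT \<omega>|M. iexp (W n \<omega> * (V n \<omega> \<bullet> z))) = \<psi>"
  shows "(LINT \<omega>|M. iexp ((\<Sum>n=1..N \<omega>. W n \<omega> *\<^sub>R V n \<omega>) \<bullet> z)) = exp (of_real m * (\<psi> - 1))"
proof -
  define G where "G k \<omega> = indicator {k} (N \<omega>) * (\<Prod>n=1..k. iexp (W n \<omega> * (V n \<omega> \<bullet> z)))" for k \<omega>
  \<comment> \<open>For each outcome at most one summand is nonzero, so the partial sums are bounded
    by 1 and eventually constant.\<close>
  have G: "(\<Sum>k<j. G k \<omega>) = (if N \<omega> < j then iexp ((\<Sum>n=1..N \<omega>. W n \<omega> *\<^sub>R V n \<omega>) \<bullet> z) else 0)" for j \<omega>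
  proof -
    have "G k \<omega> = (if k = N \<omega> then iexp ((\<Sum>n=1..N \<omega>. W n \<omega> *\<^sub>R V n \<omega>) \<bullet> z) else 0)" for k
      by (auto simp: G_def inner_sum_left sum_distrib_left exp_sum)
    then show ?thesis by (simp add: sum.delta)
  qed
  have Gm: "G k \<in> borel_measurable M" for k
  proof -
    have [measurable]: "(\<lambda>\<omega>. indicator {k} (N \<omega>) :: complex) \<in> borel_measurable M"
      by (rule measurable_compose[OF N]) simp
    show ?thesis unfolding G_def by (intro borel_measurable_times borel_measurable_prod) auto
  qed
  have Gi: "integrable M (G k)" for k
  proof (intro integrable_const_bound[where B=1] Gm AE_I2)
    fix \<omega>
    have "norm (\<Prod>n=1..k. iexp (W n \<omega> * (V n \<omega> \<bullet> z))) = 1" by (simp flip: prod_norm)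
    then show "norm (G k \<omega>) \<le> 1" unfolding G_def norm_mult by (simp add: indicator_def)
  qed
  have "(\<lambda>j. LINT \<omega>|M. (\<Sum>k<j. G k \<omega>)) \<longlonglongrightarrow> (LINT \<omega>|M. iexp ((\<Sum>n=1..N \<omega>. W n \<omega> *\<^sub>R V n \<omega>) \<bullet> z))"
  proof (rule integral_dominated_convergence[where w="\<lambda>_. 1"])
    show "AE \<omega> in M. (\<lambda>j. \<Sum>k<j. G k \<omega>) \<longlonglongrightarrow> iexp ((\<Sum>n=1..N \<omega>. W n \<omega> *\<^sub>R V n \<omega>) \<bullet> z)"
    proof (intro AE_I2 tendsto_eventually)
      fix \<omega>
      show "\<forall>\<^sub>F j in sequentially. (\<Sum>k<j. G k \<omega>) = iexp ((\<Sum>n=1..N \<omega>. W n \<omega> *\<^sub>R V n \<omega>) \<bullet> z)"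
        using eventually_gt_at_top[of "N \<omega>"] by eventually_elim (simp add: G)
    qed
    show "(\<lambda>\<omega>. \<Sum>k<j. G k \<omega>) \<in> borel_measurable M" for j by (intro borel_measurable_sum Gm)
    show "AE \<omega> in M. norm (\<Sum>k<j. G k \<omega>) \<le> 1" for j unfolding G by auto
  qed auto
  moreover have "(\<lambda>j. LINT \<omega>|M. (\<Sum>k<j. G k \<omega>)) \<longlonglongrightarrow> exp (of_real m * \<psi>) * exp (- of_real m)"
  proof -
    have "(LINT \<omega>|M. (\<Sum>k<j. G k \<omega>)) = (\<Sum>k<j. (of_real m * \<psi>) ^ k /\<^sub>R fact k) * exp (- of_real m)" for j
    proof -
      have "(LINT \<omega>|M. (\<Sum>k<j. G k \<omega>)) = (\<Sum>k<j. of_real (m ^ k / fact k * exp (- m)) * \<psi> ^ k)"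
      proof -
        have "(LINT \<omega>|M. G k \<omega>) = of_real (m ^ k / fact k * exp (- m)) * \<psi> ^ k" for k
          unfolding G_def by (rule integral_count_prod[OF \<psi>])
        then show ?thesis by (subst Bochner_Integration.integral_sum) (simp_all only: Gi)
      qed
      also have "\<dots> = (\<Sum>k<j. (of_real m * \<psi>) ^ k /\<^sub>R fact k) * exp (- of_real m)"
        unfolding sum_distrib_right
        by (intro sum.cong refl) (simp add: scaleR_conv_of_real power_mult_distrib exp_of_real[symmetric] field_simps)
      finally show ?thesis .
    qed
    moreover have "(\<lambda>j. \<Sum>k<j. (of_real m * \<psi>) ^ k /\<^sub>R fact k) \<longlonglongrightarrow> exp (of_real m * \<psi>)"
      using exp_converges[of "of_real m * \<psi>"] by (simp add: sums_def)
    ultimately show ?thesis by (simp only:) (intro tendsto_mult tendsto_const)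
  qed
  ultimately have "(LINT \<omega>|M. iexp ((\<Sum>n=1..N \<omega>. W n \<omega> *\<^sub>R V n \<omega>) \<bullet> z)) = exp (of_real m * \<psi>) * exp (- of_real m)"
    by (rule LIMSEQ_unique)
  then show ?thesis by (simp add: exp_add[symmetric] algebra_simps)
qed

end

section \<open>The transition law\<close>

text \<open>The hypothesis \<open>joint\<close> says that \<open>Y - a X\<close> is independent of
  \<open>X\<close> with law \<open>\<kappa>\<close>; conditionally on \<open>X = x\<close>,
  \<open>Y\<close> is then \<open>\<kappa>\<close> shifted by \<open>a x\<close>. The defining
  integrals over the events \<open>X \<in> C\<close> are compared by Fubini.\<close>

lemma cond_distribution_indep_increment:
  fixes X Y :: "'w \<Rightarrow> 'a::euclidean_space"
  assumes "prob_space M" and [measurable]: "X \<in> borel_measurable M" "Y \<in> borel_measurable M"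
    and \<kappa>: "prob_space \<kappa>" "sets \<kappa> = sets borel"
    and joint: "distr M (borel \<Otimes>\<^sub>M borel) (\<lambda>\<omega>. (X \<omega>, Y \<omega> - a *\<^sub>R X \<omega>)) = distr M borel X \<Otimes>\<^sub>M \<kappa>"
  shows "cond_distribution M Y X (\<lambda>x. distr \<kappa> borel (\<lambda>y. a *\<^sub>R x + y))"
proof -
  interpret prob_space M by fact
  interpret k: prob_space \<kappa> by fact
  interpret X: prob_space "distr M borel X" by (rule prob_space_distr) simp
  interpret Xk: pair_prob_space "distr M borel X" \<kappa> ..
  note \<kappa>(2)[measurable_cong]
  let ?K = "\<lambda>x. distr \<kappa> borel (\<lambda>y. a *\<^sub>R x + y)"
  have "\<kappa> \<in> space (prob_algebra borel)" using \<kappa> by (simp add: space_prob_algebra)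
  then have K [measurable]: "?K \<in> borel \<rightarrow>\<^sub>M prob_algebra borel"
    by (intro measurable_distr_prob_space2[where M=borel]) measurable
  have Km: "(\<lambda>x. measure (?K x) B) \<in> borel_measurable borel" if "B \<in> sets borel" for B
    using that by measurable
  let ?F = "vimage_algebra (space M) X borel"
  have sub: "subalgebra M ?F"
    unfolding subalgebra_def by (intro conjI sets_image_in_sets) simp_all
  interpret F: finite_measure_subalgebra M ?F by unfold_locales (rule sub)
  show ?thesis
    unfolding cond_distribution_def
  proof (intro conjI ballI)
    show "?K \<in> borel \<rightarrow>\<^sub>M prob_algebra borel" by (rule K)
    fix B :: "'a set" assume B [measurable]: "B \<in> sets borel"
    note Km[OF B, measurable]
    show "AE \<omega> in M. real_cond_exp M ?F (indicator (Y -` B \<inter> space M)) \<omega> = measure (?K (X \<omega>)) B"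
    proof (rule F.real_cond_exp_charact)
      show "integrable M (indicat_real (Y -` B \<inter> space M))"
        by (intro integrable_real_indicator) (auto simp: less_top[symmetric])
      have K1: "\<bar>measure (?K x) B\<bar> \<le> 1" for x
        by (simp add: prob_space.prob_le_1 k.prob_space_distr)
      show "integrable M (\<lambda>\<omega>. measure (?K (X \<omega>)) B)"
        by (rule integrable_const_bound[where B=1]) (use K1 in auto)
      show "(\<lambda>\<omega>. measure (?K (X \<omega>)) B) \<in> borel_measurable ?F"
        by (rule measurable_compose[OF measurable_vimage_algebra1 Km[OF B]]) simp
      fix A assume "A \<in> sets ?F"
      then obtain C where C [measurable]: "C \<in> sets borel" and A: "A = X -` C \<inter> space M"
        by (auto simp: sets_vimage_algebra2)
      let ?f = "\<lambda>x y. indicat_real C x * indicat_real B (a *\<^sub>R x + y)"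
      have "(LINT \<omega>:A|M. indicat_real (Y -` B \<inter> space M) \<omega>) = (LINT \<omega>|M. case_prod ?f (X \<omega>, Y \<omega> - a *\<^sub>R X \<omega>))"
        unfolding set_lebesgue_integral_def A
        by (intro Bochner_Integration.integral_cong refl) (auto simp: indicator_def)
      also have "\<dots> = (LINT z|distr M (borel \<Otimes>\<^sub>M borel) (\<lambda>\<omega>. (X \<omega>, Y \<omega> - a *\<^sub>R X \<omega>)). case_prod ?f z)"
        by (subst integral_distr) auto
      also have "\<dots> = (LINT z|(distr M borel X \<Otimes>\<^sub>M \<kappa>). case_prod ?f z)" by (simp only: joint)
      also have "\<dots> = (LINT x|distr M borel X. (LINT y|\<kappa>. ?f x y))"
        by (subst Xk.integral_fst'[symmetric])
           (auto intro!: Xk.P.integrable_const_bound[where B=1] simp: split_beta indicator_def)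
      also have "\<dots> = (LINT x|distr M borel X. indicat_real C x * measure (?K x) B)"
      proof (intro Bochner_Integration.integral_cong refl)
        fix x
        have "(LINT y|\<kappa>. indicat_real B (a *\<^sub>R x + y)) = (LINT y|?K x. indicat_real B y)"
          by (subst integral_distr) auto
        then show "(LINT y|\<kappa>. ?f x y) = indicat_real C x * measure (?K x) B" by simp
      qed
      also have "\<dots> = (LINT \<omega>|M. indicat_real C (X \<omega>) * measure (?K (X \<omega>)) B)"
        by (subst integral_distr) auto
      also have "\<dots> = (LINT \<omega>:A|M. measure (?K (X \<omega>)) B)"
        unfolding set_lebesgue_integral_def A
        by (intro Bochner_Integration.integral_cong refl) (auto simp: indicator_def)
      finally show "(LINT \<omega>:A|M. indicat_real (Y -` B \<inter> space M) \<omega>) = (LINT \<omega>:A|M. measure (?K (X \<omega>)) B)" .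
    qed
  qed
qed

lemma char_fun_pair_measure:
  fixes \<mu> \<nu> :: "'a::euclidean_space measure"
  assumes "prob_space \<mu>" "prob_space \<nu>" and [measurable_cong]: "sets \<mu> = sets borel" "sets \<nu> = sets borel"
  shows "char_fun (\<mu> \<Otimes>\<^sub>M \<nu>) (z, w) = char_fun \<mu> z * char_fun \<nu> w"
proof -
  interpret pair_prob_space \<mu> \<nu> using assms unfolding pair_prob_space_def pair_sigma_finite_def
    by (auto intro: prob_space_imp_sigma_finite)
  have "char_fun (\<mu> \<Otimes>\<^sub>M \<nu>) (z, w) = (LINT p|(\<mu> \<Otimes>\<^sub>M \<nu>). (case p of (x, y) \<Rightarrow> iexp (x \<bullet> z) * iexp (y \<bullet> w)))"
    unfolding char_fun_def
    by (intro Bochner_Integration.integral_cong refl) (auto simp: inner_prod_def distrib_left exp_add)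
  also have "\<dots> = (LINT x|\<mu>. (LINT y|\<nu>. iexp (x \<bullet> z) * iexp (y \<bullet> w)))"
    by (subst integral_fst'[symmetric])
       (auto intro!: P.integrable_const_bound[where B=1] simp: split_beta norm_mult)
  also have "\<dots> = char_fun \<mu> z * char_fun \<nu> w"
    by (simp add: char_fun_def)
  finally show ?thesis .
qed

section \<open>The jump part of the exponent and its integral along the decay\<close>

definition jump_exponent :: "'a::euclidean_space measure \<Rightarrow> real measure \<Rightarrow> 'a \<Rightarrow> complex" where
  "jump_exponent R T z = (LINT x|R. (LINT u|T. iexp (u * (x \<bullet> z)) - 1))"

text \<open>\<open>T\<close> stands for the tempering measure. With both measures finite the
  integrand, bounded by 2, is integrable on the product, which gives Fubini and continuity in the
  frequency.\<close>

locale jump_measures = R: finite_measure R + T: finite_measure T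
  for R :: "'a::euclidean_space measure" and T :: "real measure" +
  assumes sets_R [measurable_cong, simp]: "sets R = sets borel" and sets_T [measurable_cong, simp]: "sets T = sets borel"
begin

sublocale RT: pair_sigma_finite R T ..
sublocale P: finite_measure "R \<Otimes>\<^sub>M T" by (rule finite_measure_pair_measure) unfold_locales

lemma norm_iexp_minus_1: "norm (iexp y - 1) \<le> 2"
  using norm_triangle_ineq4[of "iexp y" 1] by simp

lemma jump_exponent_pair:
  "jump_exponent R T z = (LINT p|(R \<Otimes>\<^sub>M T). iexp (snd p * (fst p \<bullet> z)) - 1)"
  unfolding jump_exponent_def
  by (subst RT.integral_fst'[symmetric])
     (auto intro!: P.integrable_const_bound[where B=2] AE_I2 norm_iexp_minus_1 simp del: of_real_mult)

lemma continuous_on_jump_exponent: "continuous_on S (jump_exponent R T)"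
proof (rule continuous_on_sequentiallyI)
  fix v :: "nat \<Rightarrow> 'a" and a assume "v \<longlonglongrightarrow> a"
  then show "(\<lambda>n. jump_exponent R T (v n)) \<longlonglongrightarrow> jump_exponent R T a"
    unfolding jump_exponent_pair
    by (intro integral_dominated_convergence[where w="\<lambda>_. 2"])
       (auto intro!: AE_I2 tendsto_intros norm_iexp_minus_1 simp del: of_real_mult)
qed

lemma jump_exponent_0: "jump_exponent R T 0 = 0"
  by (simp add: jump_exponent_def)

end

lemma TS_exponent_eq:
  assumes "0 \<le> c" and [measurable_cong]: "sets R = sets borel"
  shows "TS_exponent p \<alpha> (scale_measure (ennreal c) R) b z =
    \<i> * of_real (b \<bullet> z) + of_real c * jump_exponent R (tempering_measure p \<alpha>) z"
proof -
  interpret T: sigma_finite_measure "tempering_measure p \<alpha>" by (rule sigma_finite_tempering)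
  have inner: "(LINT u:{0<..}|lborel. (iexp (u * (x \<bullet> z)) - 1) * of_real (u powr (- 1 - \<alpha>) * exp (- (u powr p)))) =
     (LINT u|tempering_measure p \<alpha>. iexp (u * (x \<bullet> z)) - 1)" for x
  proof -
    have "(LINT u|tempering_measure p \<alpha>. iexp (u * (x \<bullet> z)) - 1) =
        (LINT u|lborel. (indicator {0<..} u * tempering_density p \<alpha> u) *\<^sub>R (iexp (u * (x \<bullet> z)) - 1))"
      unfolding tempering_measure_def by (subst integral_density) auto
    also have "\<dots> = (LINT u:{0<..}|lborel. (iexp (u * (x \<bullet> z)) - 1) * of_real (u powr (- 1 - \<alpha>) * exp (- (u powr p))))"
      unfolding set_lebesgue_integral_def
      by (intro Bochner_Integration.integral_cong refl)
         (simp add: tempering_density_def scaleR_conv_of_real mult_ac)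
    finally show ?thesis by simp
  qed
  have "(\<lambda>x. LINT u|tempering_measure p \<alpha>. iexp (u * (x \<bullet> z)) - 1) \<in> borel_measurable R"
    by (rule T.borel_measurable_lebesgue_integral) measurable
  then show ?thesis
    unfolding TS_exponent_def inner jump_exponent_def using assms(1)
    by (subst integral_scale_measure) (auto simp: scaleR_conv_of_real)
qed

text \<open>With q = exp (rate * (t - r)) one has rate dr = - dq / q and exp (- rate * (t - r)) = 1
  / q. This is where the factor \<open>rate\<close> of the BDLP parameters goes.\<close>

lemma integral_log_uniform_substitution:
  fixes F :: "real \<Rightarrow> complex"
  assumes "rate > 0" "t > 0" and F: "continuous_on UNIV F"
  shows "(LINT r:{0<..t}|lborel. of_real rate * F (exp (- (rate * (t - r))))) =
     (LINT q|log_uniform (exp (rate * t)). F (1 / q))"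
proof -
  let ?f = "\<lambda>y. of_real (1 / y) * F (1 / y)" and ?g = "\<lambda>r. exp (rate * (t - r))"
  have [measurable]: "F \<in> borel_measurable borel" using F by (rule borel_measurable_continuous_onI)
  have g: "?g 0 = exp (rate * t)" "?g t = 1" by simp_all
  have "(LBINT r=ereal 0..ereal t. (- rate * ?g r) *\<^sub>R ?f (?g r)) = (LBINT y=ereal (?g 0)..ereal (?g t). ?f y)"
  proof (rule interval_integral_substitution_finite)
    show "continuous_on (?g ` {0..t}) ?f"
      by (intro continuous_intros continuous_on_compose2[OF F]) auto
    show "(?g has_real_derivative - rate * ?g r) (at r within {0..t})" for r
      by (auto intro!: derivative_eq_intros)
  qed (use assms in \<open>auto intro!: continuous_intros\<close>)
  \<comment> \<open>The substitution is decreasing: reversing the endpoints produces a sign that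
    cancels the one of the derivative \<open>- rate * ?g r\<close>.\<close>
  also have "\<dots> = - (LBINT y=ereal 1..ereal (exp (rate * t)). ?f y)"
    unfolding g by (rule interval_integral_endpoints_reverse)
  also have "(LBINT y=ereal 1..ereal (exp (rate * t)). ?f y) = (LINT y:{1..exp (rate * t)}|lborel. ?f y)"
    using assms by (intro interval_integral_Icc) simp
  also have "(LINT y:{1..exp (rate * t)}|lborel. ?f y) = (LINT q|log_uniform (exp (rate * t)). F (1 / q))"
    unfolding log_uniform_def set_lebesgue_integral_def
    by (subst integral_density) (auto intro!: Bochner_Integration.integral_cong AE_I2 simp: indicator_def scaleR_conv_of_real)
  also have "(LBINT r=ereal 0..ereal t. (- rate * ?g r) *\<^sub>R ?f (?g r)) =
      (LINT r:{0<..t}|lborel. (- rate * ?g r) *\<^sub>R ?f (?g r))"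
    using assms by (intro interval_integral_Ioc) simp
  also have "\<dots> = (LINT r:{0<..t}|lborel. - (of_real rate * F (exp (- (rate * (t - r))))))"
  proof (intro set_lebesgue_integral_cong allI impI)
    fix r
    have "1 / ?g r = exp (- (rate * (t - r)))" by (simp add: exp_minus inverse_eq_divide)
    moreover have "of_real (?g r) * complex_of_real (1 / ?g r) = 1" by (simp flip: of_real_mult)
    ultimately show "(- rate * ?g r) *\<^sub>R ?f (?g r) = - (of_real rate * F (exp (- (rate * (t - r)))))"
      by (simp add: scaleR_conv_of_real mult.assoc)
  qed simp
  also have "\<dots> = - (LINT r:{0<..t}|lborel. of_real rate * F (exp (- (rate * (t - r)))))"
    unfolding set_lebesgue_integral_def scaleR_minus_right by (rule Bochner_Integration.integral_minus)
  finally show ?thesis by simp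
qed

text \<open>The drift integrates to \<open>1 - exp (- (rate * t))\<close>, the weight of
  \<open>b\<close> in the transition law; the jump part becomes a \<open>log_uniform\<close>
  integral by the substitution.\<close>

lemma (in jump_measures) integral_decayed_exponent:
  assumes "rate > 0" "t > 0"
  shows "(LINT r:{0<..t}|lborel. \<i> * of_real ((rate *\<^sub>R b) \<bullet> (exp (- (rate * (t - r))) *\<^sub>R w)) +
       of_real rate * jump_exponent R T (exp (- (rate * (t - r))) *\<^sub>R w)) =
     \<i> * of_real ((1 - exp (- (rate * t))) * (b \<bullet> w)) +
     (LINT q|log_uniform (exp (rate * t)). jump_exponent R T ((1 / q) *\<^sub>R w))"
proof -
  let ?J = "\<lambda>y. jump_exponent R T (y *\<^sub>R w)"
  have J: "continuous_on S ?J" for S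
    by (intro continuous_on_compose2[OF continuous_on_jump_exponent[of UNIV]] continuous_intros) auto
  have int: "set_integrable lborel {0<..t} f" if "continuous_on {0..t} f" for f :: "real \<Rightarrow> complex"
  proof -
    have "set_integrable lborel {0..t} f"
      using that unfolding set_integrable_def by (intro borel_integrable_compact compact_Icc)
    then show ?thesis by (rule set_integrable_subset) auto
  qed
  have "(LINT r:{0<..t}|lborel. \<i> * of_real ((rate *\<^sub>R b) \<bullet> (exp (- (rate * (t - r))) *\<^sub>R w)) +
       of_real rate * jump_exponent R T (exp (- (rate * (t - r))) *\<^sub>R w)) =
     (LINT r:{0<..t}|lborel. \<i> * of_real ((rate *\<^sub>R b) \<bullet> (exp (- (rate * (t - r))) *\<^sub>R w))) +
     (LINT r:{0<..t}|lborel. of_real rate * ?J (exp (- (rate * (t - r)))))"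
    by (intro set_integral_add int continuous_intros continuous_on_compose2[OF J[of UNIV]]) auto
  also have "(LINT r:{0<..t}|lborel. of_real rate * ?J (exp (- (rate * (t - r))))) =
      (LINT q|log_uniform (exp (rate * t)). ?J (1 / q))"
    by (rule integral_log_uniform_substitution[OF assms J])
  also have "(LINT r:{0<..t}|lborel. \<i> * of_real ((rate *\<^sub>R b) \<bullet> (exp (- (rate * (t - r))) *\<^sub>R w))) =
      (LINT r:{0<..t}|lborel. (\<i> * of_real ((b \<bullet> w) * exp (- (rate * t)))) * of_real (rate * exp (rate * r)))"
    by (intro set_lebesgue_integral_cong) (auto simp: right_diff_distrib exp_diff exp_minus field_simps)
  also have "\<dots> = (\<i> * of_real ((b \<bullet> w) * exp (- (rate * t)))) * of_real (exp (rate * t) - 1)"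
    using set_integral_Ioc_exp[of 0 t rate] assms
    by (subst set_integral_mult_right, subst set_integral_complex_of_real) simp
  also have "\<dots> = \<i> * of_real ((b \<bullet> w) * (exp (- (rate * t)) * (exp (rate * t) - 1)))"
    by simp
  also have "exp (- (rate * t)) * (exp (rate * t) - 1) = 1 - exp (- (rate * t))"
    by (simp add: right_diff_distrib exp_minus)
  finally show ?thesis by (simp add: mult.commute)
qed

text \<open>Once the integral over \<open>R\<close> is moved outside, the integrals over
  \<open>q\<close> and \<open>u\<close> form a \<open>DGGa\<close> expectation up to the constant of
  \<open>integral_DGGa\<close>. The inverse of that constant appears here, and with ln \<eta> = rate
  * t it contributes all of the Poisson mean except the mass of \<open>R\<close>.\<close>

lemma integral_log_uniform_jump_exponent:
  fixes R :: "'a::euclidean_space measure"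
  assumes "\<eta> > 1" "p > 0" "\<alpha> < 0" and D: "prob_space (DGGa (- \<alpha>) p \<eta>)"
    and "finite_measure R" and [measurable_cong]: "sets R = sets borel"
  shows "(LINT q|log_uniform \<eta>. jump_exponent R (tempering_measure p \<alpha>) ((1 / q) *\<^sub>R w)) =
    of_real (Gamma (- \<alpha> / p) / p * ln \<eta>) * (LINT x|R. (LINT v|DGGa (- \<alpha>) p \<eta>. iexp (v * (x \<bullet> w)) - 1))"
proof -
  let ?T = "tempering_measure p \<alpha>" and ?Q = "log_uniform \<eta>"
  interpret T: finite_measure ?T by (rule finite_tempering_measure[OF assms(1-4)])
  interpret jump_measures R ?T
    using assms by (auto simp: jump_measures_def jump_measures_axioms_def intro: T.finite_measure_axioms)
  interpret Q: finite_measure ?Q using assms by (intro finite_log_uniform) auto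
  interpret QR: pair_sigma_finite ?Q R ..
  interpret QRf: finite_measure "?Q \<Otimes>\<^sub>M R" by (rule finite_measure_pair_measure) unfold_locales
  let ?h = "\<lambda>q x. LINT u|?T. iexp (u / q * (x \<bullet> w)) - 1"
  have h: "integrable (?Q \<Otimes>\<^sub>M R) (case_prod ?h)"
  \<comment> \<open>The integrand of the inner integral is bounded by 2, so the inner integral is at
    most twice the mass of the tempering measure.\<close>
  proof (rule QRf.integrable_const_bound[where B="2 * measure ?T (space ?T)"])
    have "(\<lambda>y. LINT u|?T. iexp (u / fst y * (snd y \<bullet> w)) - 1) \<in> borel_measurable (?Q \<Otimes>\<^sub>M R)"
      by (rule T.borel_measurable_lebesgue_integral) measurable
    then show "case_prod ?h \<in> borel_measurable (?Q \<Otimes>\<^sub>M R)" by (simp add: split_beta')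
    have "norm (?h q x) \<le> 2 * measure ?T (space ?T)" for q x
    proof -
      have "norm (?h q x) \<le> (LINT u|?T. norm (iexp (u / q * (x \<bullet> w)) - 1))" by (rule integral_norm_bound)
      also have "\<dots> \<le> (LINT u|?T. 2)"
        by (intro integral_mono T.integrable_const_bound[where B=2] norm_iexp_minus_1 integrable_norm)
           (auto intro!: AE_I2 norm_iexp_minus_1 simp del: of_real_mult of_real_divide)
      finally show ?thesis by simp
    qed
    then show "AE y in ?Q \<Otimes>\<^sub>M R. norm (case_prod ?h y) \<le> 2 * measure ?T (space ?T)" by auto
  qed
  have "(LINT q|?Q. jump_exponent R ?T ((1 / q) *\<^sub>R w)) = (LINT q|?Q. (LINT x|R. ?h q x))"
    by (simp add: jump_exponent_def)
  also have "\<dots> = (LINT x|R. (LINT q|?Q. ?h q x))" by (rule QR.Fubini_integral[OF h, symmetric])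
  also have "\<dots> = (LINT x|R. of_real (Gamma (- \<alpha> / p) / p * ln \<eta>) * (LINT v|DGGa (- \<alpha>) p \<eta>. iexp (v * (x \<bullet> w)) - 1))"
  proof (intro Bochner_Integration.integral_cong refl)
    fix x
    have "(LINT v|DGGa (- \<alpha>) p \<eta>. iexp (v * (x \<bullet> w)) - 1) = (p / Gamma (- \<alpha> / p) / ln \<eta>) *\<^sub>R (LINT q|?Q. ?h q x)"
      by (rule integral_DGGa[OF assms(1-4), of "\<lambda>v. iexp (v * (x \<bullet> w)) - 1" 2]) (auto intro: norm_iexp_minus_1 simp del: of_real_mult)
    then show "(LINT q|?Q. ?h q x) = of_real (Gamma (- \<alpha> / p) / p * ln \<eta>) * (LINT v|DGGa (- \<alpha>) p \<eta>. iexp (v * (x \<bullet> w)) - 1)"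
      using assms(1,2) Gamma_quotient_pos[OF assms(2,3)] by (simp add: scaleR_conv_of_real)
  qed
  finally show ?thesis by simp
qed

theorem theorem4p3:
  fixes p \<alpha> rate s t :: real
    and b :: "real ^ 'd"
    and R :: "(real ^ 'd) measure"
    and M :: "'w measure"
    and L Y :: "real \<Rightarrow> 'w \<Rightarrow> real ^ 'd"
    and M' :: "'v measure"
    and N :: "'v \<Rightarrow> nat"
    and V :: "nat \<Rightarrow> 'v \<Rightarrow> real ^ 'd"
    and W :: "nat \<Rightarrow> 'v \<Rightarrow> real"
  assumes "p > 0" and "\<alpha> < 0" and "rate > 0"
    and "finite_measure R" and "sets R = sets borel"
    and "R \<noteq> null_measure borel" and "emeasure R {0} = 0"
    and "OUTS_process M rate p \<alpha> (scale_measure (ennreal rate) R) (rate *\<^sub>R b) L Y"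
    and "t > 0" and "s \<ge> 0"
    and "prob_space M'"
    and "N \<in> M' \<rightarrow>\<^sub>M count_space UNIV"
    and "\<And>n. n \<ge> 1 \<Longrightarrow> V n \<in> borel_measurable M'"
    and "\<And>n. n \<ge> 1 \<Longrightarrow> W n \<in> borel_measurable M'"
    and "indep_NVW M' N V W"
    and "\<And>n. n \<ge> 1 \<Longrightarrow> distr M' borel (V n) = scale_measure (1 / emeasure R UNIV) R"
    and "\<And>n. n \<ge> 1 \<Longrightarrow> distr M' borel (W n) = DGGa \<bar>\<alpha>\<bar> p (exp (rate * t))"
    and "distr M' (count_space UNIV) N =
           measure_pmf (poisson_pmf (1 / p * rate * t * Gamma (\<bar>\<alpha>\<bar> / p) * measure R UNIV))"
  shows "cond_distribution M (Y (s + t)) (Y s)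
           (\<lambda>y. distr M' borel (\<lambda>\<omega>. exp (- rate * t) *\<^sub>R y + (1 - exp (- rate * t)) *\<^sub>R b
                                   + (\<Sum>n=1..N \<omega>. W n \<omega> *\<^sub>R V n \<omega>)))"
proof -
  let ?T = "tempering_measure p \<alpha>" and ?\<eta> = "exp (rate * t)"
  interpret M': prob_space M' by fact
  interpret R: finite_measure R by fact
  note p = \<open>p > 0\<close> and \<alpha> = \<open>\<alpha> < 0\<close> and rate = \<open>rate > 0\<close> and t = \<open>t > 0\<close> and s = \<open>s \<ge> 0\<close>
  note R_sets [measurable_cong] = \<open>sets R = sets borel\<close>
  have R_space: "space R = UNIV" using sets_eq_imp_space_eq[OF R_sets] by simp
  have \<eta>: "?\<eta> > 1" using rate t by simp
  have abs_\<alpha>: "\<bar>\<alpha>\<bar> = - \<alpha>" using \<alpha> by simp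
  have "W 1 \<in> borel_measurable M'" using assms(14)[of 1] by simp
  \<comment> \<open>\<open>DGGa\<close> is the law of a random variable by hypothesis, hence a
    probability measure; the finiteness of the tempering measure rests on this.\<close>
  then have D: "prob_space (DGGa (- \<alpha>) p ?\<eta>)"
    using M'.prob_space_distr assms(17)[of 1] abs_\<alpha> by (metis order_refl)
  interpret T: finite_measure ?T by (rule finite_tempering_measure[OF \<eta> p \<alpha> D])
  interpret jump_measures R ?T
    unfolding jump_measures_def jump_measures_axioms_def
    using R_sets R.finite_measure_axioms T.finite_measure_axioms by simp
  define r where "r = measure R UNIV"
  have "emeasure R UNIV \<noteq> 0"
  proof
    assume "emeasure R UNIV = 0"
    then have "emeasure R A = 0" for A
      using emeasure_mono[of A UNIV R] R_space sets.top[of R] by (cases "A \<in> sets R") (auto simp: emeasure_notin_sets)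
    then have "R = null_measure borel" by (intro measure_eqI) (auto simp: R_sets)
    with assms(6) show False by simp
  qed
  then have r: "r > 0" unfolding r_def by (metis R.emeasure_eq_measure ennreal_0 measure_nonneg order_le_less)
  have R1: "1 / emeasure R UNIV = ennreal (1 / r)"
    using r by (simp add: R.emeasure_eq_measure r_def[symmetric] divide_ennreal flip: ennreal_1)
  define m where "m = 1 / p * rate * t * Gamma (\<bar>\<alpha>\<bar> / p) * measure R UNIV"
  have m: "m > 0"
    unfolding m_def r_def[symmetric] abs_\<alpha> using p rate t r Gamma_quotient_pos[OF p \<alpha>] by simp
  interpret cp: compound_poisson M' N V W m
    by unfold_locales (use assms m in \<open>auto simp: m_def\<close>)
  define S where "S \<omega> = (\<Sum>n=1..N \<omega>. W n \<omega> *\<^sub>R V n \<omega>)" for \<omega>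
  have S_meas [measurable]: "S \<in> borel_measurable M'" unfolding S_def by (rule cp.measurable_random_sum)
  define \<kappa> where "\<kappa> = distr M' borel (\<lambda>\<omega>. (1 - exp (- rate * t)) *\<^sub>R b + S \<omega>)"
  have \<kappa>: "prob_space \<kappa>" "sets \<kappa> = sets borel"
    unfolding \<kappa>_def by (auto intro!: M'.prob_space_distr)

  have OU: "OU_process M rate L Y"
    and TS: "is_TS p \<alpha> (scale_measure (ennreal rate) R) (rate *\<^sub>R b) (distr M borel (L 1))"
    using assms(8) by (auto simp: OUTS_process_def)
  interpret levy M L
    using OU by (auto simp: OU_process_def levy_process_def levy_def levy_axioms_def)
  define c where "c z = \<i> * of_real ((rate *\<^sub>R b) \<bullet> z) + of_real rate * jump_exponent R ?T z" for z
  have phi_1: "phi 1 z = exp (c z)" for z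
    using TS rate unfolding is_TS_def c_def by (simp add: TS_exponent_eq[OF _ R_sets])
  have c_cont: "continuous_on UNIV c"
    unfolding c_def by (intro continuous_intros continuous_on_jump_exponent)
  have c_0: "c 0 = 0" by (simp add: c_def jump_exponent_0)

  have char_\<kappa>: "char_fun \<kappa> w = exp (LINT u:{0<..t}|lborel. c (exp (- (rate * (t - u))) *\<^sub>R w))" for w
  proof -
    define \<Psi> where "\<Psi> x = (LINT v|DGGa (- \<alpha>) p ?\<eta>. iexp (v * (x \<bullet> w)))" for x
    \<comment> \<open>The value at \<open>w\<close> of the characteristic function of a single jump
      \<open>V n\<close> times \<open>W n\<close>, with \<open>1 / r\<close> normalising
      \<open>R\<close>.\<close>
    define \<psi> where "\<psi> = of_real (1 / r) * (LINT x|R. \<Psi> x)"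
    interpret D: prob_space "DGGa (- \<alpha>) p ?\<eta>" by (rule D)
    have [measurable_cong]: "sets (DGGa (- \<alpha>) p ?\<eta>) = sets borel" by (simp add: DGGa_def)
    have \<Psi>_meas [measurable]: "\<Psi> \<in> borel_measurable borel"
      unfolding \<Psi>_def by (rule D.borel_measurable_lebesgue_integral) measurable
    have \<Psi>_bound: "norm (\<Psi> x) \<le> 1" for x
    proof -
      have "norm (\<Psi> x) \<le> (LINT v|DGGa (- \<alpha>) p ?\<eta>. norm (iexp (v * (x \<bullet> w))))"
        unfolding \<Psi>_def by (rule integral_norm_bound)
      then show ?thesis by (simp add: D.prob_space)
    qed
    have \<Psi>_int: "integrable R \<Psi>"
      by (rule R.integrable_const_bound[where B=1]) (auto simp: \<Psi>_bound)
    have "(LINT \<omega>|M'. iexp (W n \<omega> * (V n \<omega> \<bullet> w))) = \<psi>" if "n \<ge> 1" for n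
    proof -
      have "(LINT \<omega>|M'. iexp (W n \<omega> * (V n \<omega> \<bullet> w))) =
          (LINT x|distr M' borel (V n). (LINT v|distr M' borel (W n). iexp (v * (x \<bullet> w))))"
        by (rule cp.integral_V_W[OF that, where B=1]) auto
      also have "\<dots> = (LINT x|scale_measure (ennreal (1 / r)) R. \<Psi> x)"
        by (simp add: assms(16,17)[OF that] R1 abs_\<alpha> \<Psi>_def)
      also have "\<dots> = \<psi>"
        using r by (subst integral_scale_measure) (auto simp: \<psi>_def scaleR_conv_of_real)
      finally show ?thesis .
    qed
    then have S_char: "(LINT \<omega>|M'. iexp (S \<omega> \<bullet> w)) = exp (of_real m * (\<psi> - 1))"
      unfolding S_def by (rule cp.char_random_sum)
    have "(LINT x|R. (LINT v|DGGa (- \<alpha>) p ?\<eta>. iexp (v * (x \<bullet> w)) - 1)) = (LINT x|R. \<Psi> x - 1)"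
      unfolding \<Psi>_def
      by (intro Bochner_Integration.integral_cong refl, subst Bochner_Integration.integral_diff)
         (auto simp: D.prob_space intro!: D.integrable_iexp_inner simp del: of_real_mult)
    also have "\<dots> = (LINT x|R. \<Psi> x) - of_real r"
      using \<Psi>_int by (subst Bochner_Integration.integral_diff) (auto simp: r_def R_space scaleR_conv_of_real)
    also have "\<dots> = of_real r * (\<psi> - 1)"
      using r by (simp add: \<psi>_def field_simps)
    \<comment> \<open>Here the Poisson mean arises: Gamma (- \<alpha> / p) / p times ln
      \<open>?\<eta>\<close> = rate * t times the mass \<open>r\<close> of \<open>R\<close> is
      \<open>m\<close>.\<close>
    finally have "of_real (Gamma (- \<alpha> / p) / p * ln ?\<eta>) * (LINT x|R. (LINT v|DGGa (- \<alpha>) p ?\<eta>. iexp (v * (x \<bullet> w)) - 1)) =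
        of_real m * (\<psi> - 1)"
      by (simp add: m_def r_def[symmetric] abs_\<alpha> mult_ac)
    then have jumps: "(LINT q|log_uniform ?\<eta>. jump_exponent R ?T ((1 / q) *\<^sub>R w)) = of_real m * (\<psi> - 1)"
      using integral_log_uniform_jump_exponent[OF \<eta> p \<alpha> D assms(4) R_sets] by simp
    have "char_fun \<kappa> w = (LINT \<omega>|M'. iexp ((1 - exp (- rate * t)) * (b \<bullet> w)) * iexp (S \<omega> \<bullet> w))"
      unfolding \<kappa>_def by (subst char_fun_distr) (auto simp: inner_add_left distrib_left exp_add)
    also have "\<dots> = iexp ((1 - exp (- rate * t)) * (b \<bullet> w)) * exp (of_real m * (\<psi> - 1))"
      by (simp add: S_char)
    also have "\<dots> = exp (LINT u:{0<..t}|lborel. c (exp (- (rate * (t - u))) *\<^sub>R w))"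
      unfolding c_def integral_decayed_exponent[OF rate t] jumps exp_add by simp
    finally show ?thesis .
  qed

  have Y_meas [measurable]: "Y s \<in> borel_measurable M" "Y (s + t) \<in> borel_measurable M"
    using OU s t by (auto simp: OU_process_def)
  let ?Z = "\<lambda>\<omega>. Y (s + t) \<omega> - exp (- rate * t) *\<^sub>R Y s \<omega>"
  note joint = OU_joint_char[OF OU c_cont c_0 phi_1 s t]
  have char_Ys: "char_fun (distr M borel (Y s)) z = char_fun (distr M borel (Y 0)) (exp (- (rate * s)) *\<^sub>R z) *
     exp (LINT u:{0<..s}|lborel. c (exp (- (rate * (s - u))) *\<^sub>R z))" for z
    \<comment> \<open>At \<open>w = 0\<close> the third factor is \<open>exp\<close> of the integral
      of \<open>c 0 = 0\<close>, that is 1.\<close>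
    using joint[of z 0] by (simp add: char_fun_distr c_0 set_lebesgue_integral_def)
  have "distr M (borel \<Otimes>\<^sub>M borel) (\<lambda>\<omega>. (Y s \<omega>, ?Z \<omega>)) = distr M borel (Y s) \<Otimes>\<^sub>M \<kappa>"
  proof (rule char_fun_unique)
    have Ys: "prob_space (distr M borel (Y s))" by (rule prob_space_distr) simp
    interpret Yk: pair_prob_space "distr M borel (Y s)" \<kappa>
      using Ys \<kappa> by (simp add: pair_prob_space_def pair_sigma_finite_def prob_space_imp_sigma_finite)
    show "finite_measure (distr M (borel \<Otimes>\<^sub>M borel) (\<lambda>\<omega>. (Y s \<omega>, ?Z \<omega>)))"
      by (rule finite_measure_distr) measurable
    show "finite_measure (distr M borel (Y s) \<Otimes>\<^sub>M \<kappa>)" by (rule Yk.P.finite_measure_axioms)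
    show "sets (distr M (borel \<Otimes>\<^sub>M borel) (\<lambda>\<omega>. (Y s \<omega>, ?Z \<omega>))) = sets borel"
      by (simp add: borel_prod)
    show "sets (distr M borel (Y s) \<Otimes>\<^sub>M \<kappa>) = sets borel"
      using \<kappa>(2) by (simp add: borel_prod[symmetric] cong: sets_pair_measure_cong)
    fix zw :: "(real ^ 'd) \<times> (real ^ 'd)"
    obtain z w where zw: "zw = (z, w)" by (cases zw)
    have "char_fun (distr M (borel \<Otimes>\<^sub>M borel) (\<lambda>\<omega>. (Y s \<omega>, ?Z \<omega>))) zw =
        (LINT \<omega>|M. iexp (Y s \<omega> \<bullet> z + ?Z \<omega> \<bullet> w))"
      unfolding char_fun_def zw by (subst integral_distr) (auto simp: inner_prod_def)
    also have "\<dots> = char_fun (distr M borel (Y s)) z * char_fun \<kappa> w"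
      using joint[of z w] by (simp add: char_Ys char_\<kappa>)
    also have "\<dots> = char_fun (distr M borel (Y s) \<Otimes>\<^sub>M \<kappa>) zw"
      unfolding zw using Ys \<kappa> by (intro char_fun_pair_measure[symmetric]) auto
    finally show "char_fun (distr M (borel \<Otimes>\<^sub>M borel) (\<lambda>\<omega>. (Y s \<omega>, ?Z \<omega>))) zw =
        char_fun (distr M borel (Y s) \<Otimes>\<^sub>M \<kappa>) zw" .
  qed
  then have "cond_distribution M (Y (s + t)) (Y s) (\<lambda>y. distr \<kappa> borel (\<lambda>x. exp (- rate * t) *\<^sub>R y + x))"
    using \<kappa> by (intro cond_distribution_indep_increment prob_space_axioms) auto
  also have "(\<lambda>y. distr \<kappa> borel (\<lambda>x. exp (- rate * t) *\<^sub>R y + x)) =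
      (\<lambda>y. distr M' borel (\<lambda>\<omega>. exp (- rate * t) *\<^sub>R y + (1 - exp (- rate * t)) *\<^sub>R b + S \<omega>))"
    unfolding \<kappa>_def by (subst distr_distr) (auto simp: comp_def add.assoc)
  finally show ?thesis unfolding S_def .
qed

end
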